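(* Let $p\in(0,1)$ be a constant and let $G=G_p\in\mathcal{G}_{n,p}$ be a random graph. Let $RD(G)$ be the Harary matrix of $G$, with $(i,j)$-entry $1/D(i,j)$ if $i\neq j$ and $0$ if $i=j$, and let $HE(G)=\mathscr{E}(RD(G))$ be the Harary energy of $G$. Then $$HE(G)=\Big(\frac{4}{3\pi}\sqrt{p(1-p)}+o(1)\Big)n^{3/2}\quad\text{a.s.}$$
   Context: $D(i,j)$ is the distance between vertices $i$ and $j$ in $G$. The energy of a real symmetric matrix $M$ with eigenvalues $\lambda_1,\dots,\lambda_n$ is $\mathscr{E}(M)=\sum_{i=1}^n|\lambda_i|$. $\mathcal{G}_{n,p}$ is the Erdős–Rényi random graph model on $n$ vertices, each edge chosen independently with probability $p$. "a.s." means with probability tending to $1$ as $n\to\infty$; the $o(1)$ term is bounded in absolute value by a deterministic sequence tending to $0$ with probability tending to $1$. (With probability tending to $1$ the graph is connected with diameter $2$, so the convention for distances in disconnected graphs is irrelevant.) *)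

theory Defs
  imports
    "HOL-Probability.Probability"
    "Graph_Theory.Graph_Theory"
    "Jordan_Normal_Form.Char_Poly"
begin

text \<open>
  A graph is represented by its symmetric digraph: each edge \<open>{u, v}\<close> is the pair of
  arcs \<open>(u, v)\<close> and \<open>(v, u)\<close>. The coins are indexed by the two-element subsets of
  \<open>{..<n}\<close>; every other set, singletons included, gets the default \<open>False\<close>, so there
  are no loops and no arcs leaving the vertex set.
\<close>

definition erdos_renyi :: "nat \<Rightarrow> real \<Rightarrow> nat pair_pre_digraph pmf" where
  "erdos_renyi n p =
     map_pmf (\<lambda>\<omega>. \<lparr>pverts = {..<n}, parcs = {(u, v). \<omega> {u, v}}\<rparr>)
       (Pi_pmf {e. e \<subseteq> {..<n} \<and> card e = 2} False (\<lambda>_. bernoulli_pmf p))"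

definition graph_dist :: "'a pair_pre_digraph \<Rightarrow> 'a \<Rightarrow> 'a \<Rightarrow> ereal" where
  "graph_dist G u v = wf_digraph.\<mu> (with_proj G) (\<lambda>_. 1) u v"

text \<open>
  The vertices are meant to be \<open>{..<n}\<close>. For vertices in different components the
  distance is \<open>\<infinity>\<close>, and since \<^term>\<open>real_of_ereal \<infinity> = 0\<close> and \<open>1 / 0 = 0\<close> the entry
  is then \<open>0\<close>.
\<close>

definition harary_matrix :: "nat pair_pre_digraph \<Rightarrow> real mat" where
  "harary_matrix G =
     Matrix.mat (card (pverts G)) (card (pverts G))
       (\<lambda>(i, j). if i = j then 0 else 1 / real_of_ereal (graph_dist G i j))"

text \<open>
  The multiset of roots of the characteristic polynomial lists the eigenvalues with
  multiplicity. Only real roots are counted, which for a symmetric matrix are all of them.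
\<close>

definition energy :: "real mat \<Rightarrow> real" where
  "energy M = (\<Sum>x\<in>#proots (char_poly M). \<bar>x\<bar>)"

definition harary_energy :: "nat pair_pre_digraph \<Rightarrow> real" where
  "harary_energy G = energy (harary_matrix G)"

end

theory Submission
  imports Defs "Jordan_Normal_Form.Schur_Decomposition" "HOL-Real_Asymp.Real_Asymp"
begin

text \<open>
  For almost every pair of vertices the distance is 1 or 2, so up to a negligible error the Harary
  matrix has off-diagonal entries \<open>(1 + \<xi>\<^sub>i\<^sub>j) / 2\<close>, where \<open>\<xi>\<^sub>i\<^sub>j\<close> is the coin of the pair. Centring the
  coins writes it as \<open>\<surd>n / 2\<close> times the Wigner matrix \<open>X = ((\<xi>\<^sub>i\<^sub>j - p) / \<surd>n)\<close>, plus
  \<open>(1 + p) / 2\<close> times the all-ones matrix without its diagonal, plus the error. The energy is a norm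
  on symmetric matrices (\<open>array_energy_triangle\<close>): the second summand has energy at most \<open>2 n\<close>, and
  the error has energy at most \<open>\<surd>n\<close> times its Frobenius norm, so it suffices that the expected
  number of pairs without a common neighbour is \<open>o(n\<^sup>2)\<close>. What remains is
  that the energy of \<open>X\<close> divided by \<open>n\<close> converges to \<open>8 s / (3 \<pi>)\<close> in mean, where
  \<open>s\<^sup>2 = p (1 - p)\<close>; this is a form of the semicircle law.

  The absolute value is resolved by Coulson's integral
  \<open>\<bar>\<lambda>\<bar> = (2 / \<pi>) \<integral> \<lambda>\<^sup>2 / (\<lambda>\<^sup>2 + y\<^sup>2) dy\<close> over \<open>y \<ge> 0\<close>. Averaged over the spectrum of \<open>X\<close>, the
  integrand is \<open>1 - y Im S(y)\<close>, where \<open>S(y)\<close> is the normalised trace of the resolvent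
  \<open>G = (X - \<i> y)\<^sup>-\<^sup>1\<close>; only the imaginary axis is needed, and there everything is bounded by powers
  of \<open>1 / y\<close>. Three facts determine the limit of \<open>S(y)\<close>.

  \<^item> Flipping one coin changes \<open>X\<close> by a matrix of rank two and size \<open>1 / \<surd>n\<close>, so it changes the trace
    of \<open>G\<close> by \<open>O(1 / \<surd>n)\<close>. By the Efron--Stein inequality the variance of \<open>S\<close> is \<open>O(1 / n)\<close>
    (\<open>stieltjes_variance\<close>).

  \<^item> A centred coin satisfies an exact integration by parts, in which the derivative is the difference
    between the two values of the coin (\<open>coins_integration_by_parts\<close>). Applied to the trace of
    \<open>X G = 1 + \<i> y G\<close>, together with the resolvent identity, it yields
    \<open>1 + \<i> y E S + s\<^sup>2 E S\<^sup>2 = o(1)\<close> (\<open>approximate_semicircle_equation\<close>), and the variance bound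
    turns \<open>E S\<^sup>2\<close> into \<open>(E S)\<^sup>2\<close>.

  \<^item> The limiting quadratic equation has a single root in the upper half-plane, and near-solutions
    there are near this root (\<open>semicircle_equation_stability\<close>).

  Hence \<open>S(y) \<rightarrow> \<i> g(y)\<close> in mean for every \<open>y > 0\<close>, with \<open>g\<close> explicit. The averaged integrands are
  dominated by \<open>2 / (1 + y\<^sup>2)\<close>, so dominated convergence applies, and \<open>1 - y g(y)\<close> has an elementary
  antiderivative with integral \<open>4 s / 3\<close>. All convergence is in mean until Markov's inequality, at the
  very end, turns it into convergence in probability.
\<close>

section \<open>Spectral decomposition of real symmetric matrices\<close>

text \<open>
  Square matrices are handled as functions on index pairs below \<open>n\<close>, since the arguments below are
  computations with entries. Orthonormality and completeness are both included, so that neither has to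
  be derived from the other for finite families.
\<close>

definition orthonormal_family :: "nat \<Rightarrow> (nat \<Rightarrow> nat \<Rightarrow> real) \<Rightarrow> bool" where
  "orthonormal_family n u \<longleftrightarrow>
     (\<forall>k<n. \<forall>l<n. (\<Sum>i<n. u k i * u l i) = (if k = l then 1 else 0)) \<and>
     (\<forall>i<n. \<forall>j<n. (\<Sum>k<n. u k i * u k j) = (if i = j then 1 else 0))"

definition spectral :: "nat \<Rightarrow> (nat \<Rightarrow> nat \<Rightarrow> real) \<Rightarrow> (nat \<Rightarrow> real) \<Rightarrow> (nat \<Rightarrow> nat \<Rightarrow> real) \<Rightarrow> bool" where
  "spectral n a l u \<longleftrightarrow> orthonormal_family n u \<and>
     (\<forall>i<n. \<forall>j<n. a i j = (\<Sum>k<n. l k * u k i * u k j))"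

text \<open>
  A complex root of the characteristic polynomial has an eigenvector \<open>v\<close>, and symmetry makes
  \<open>v\<^sup>* A v = z v\<^sup>* v\<close> real, so the root is real.
\<close>

lemma symmetric_real_eigenvalue:
  fixes A :: "real mat"
  assumes A: "A \<in> carrier_mat n n" and sym: "A\<^sup>T = A" and n: "n > 0"
  shows "\<exists>x. eigenvalue A x"
proof -
  let ?C = "map_mat complex_of_real A"
  have C: "?C \<in> carrier_mat n n" using A by simp
  have "degree (char_poly ?C) = n" using degree_monic_char_poly[OF C] by simp
  hence "\<not> constant (poly (char_poly ?C))" using n by (simp add: constant_degree)
  then obtain z where z: "poly (char_poly ?C) z = 0"
    using fundamental_theorem_of_algebra by blast
  hence "eigenvalue ?C z" using eigenvalue_root_char_poly[OF C] by simp
  then obtain v where v: "v \<in> carrier_vec n" "v \<noteq> 0\<^sub>v n" "?C *\<^sub>v v = z \<cdot>\<^sub>v v"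
    using C unfolding eigenvalue_def eigenvector_def by auto
  have ev: "(\<Sum>j<n. complex_of_real (A $$ (i,j)) * v $ j) = z * v $ i" if "i < n" for i
  proof -
    have "(?C *\<^sub>v v) $ i = (z \<cdot>\<^sub>v v) $ i" using v(3) by simp
    thus ?thesis using that v(1) A
      by (simp add: scalar_prod_def lessThan_atLeast0 row_def)
  qed
  have symm: "A $$ (i,j) = A $$ (j,i)" if "i<n" "j<n" for i j
    using that A arg_cong[OF sym, of "\<lambda>M. M $$ (j,i)"] by simp
  define N where "N = (\<Sum>i<n. cnj (v $ i) * v $ i)"
  define S where "S = (\<Sum>i<n. \<Sum>j<n. cnj (v $ i) * complex_of_real (A $$ (i,j)) * v $ j)"
  have S1: "S = z * N"
  proof -
    have "(\<Sum>j<n. cnj (v $ i) * complex_of_real (A $$ (i,j)) * v $ j) = z * (cnj (v $ i) * v $ i)"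
      if "i < n" for i
    proof -
      have "(\<Sum>j<n. cnj (v $ i) * complex_of_real (A $$ (i,j)) * v $ j) =
          cnj (v $ i) * (\<Sum>j<n. complex_of_real (A $$ (i,j)) * v $ j)"
        by (simp add: sum_distrib_left mult.assoc)
      thus ?thesis unfolding ev[OF that] by simp
    qed
    thus ?thesis unfolding S_def N_def sum_distrib_left by (intro sum.cong refl) auto
  qed
  have "cnj S = (\<Sum>i<n. \<Sum>j<n. v $ i * complex_of_real (A $$ (i,j)) * cnj (v $ j))"
    unfolding S_def by simp
  also have "\<dots> = S"
    unfolding S_def by (subst sum.swap) (intro sum.cong refl, simp add: symm mult_ac)
  finally have S2: "cnj S = S" .
  have N: "N = complex_of_real (\<Sum>i<n. (cmod (v $ i))\<^sup>2)"
    unfolding N_def by (simp only: complex_norm_square of_real_sum) (simp add: mult.commute)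
  obtain i where i: "i < n" "v $ i \<noteq> 0"
    using v(1,2) by (metis eq_vecI carrier_vecD index_zero_vec(1) index_zero_vec(2))
  have "(\<Sum>i<n. (cmod (v $ i))\<^sup>2) > 0"
    by (rule sum_pos2[of _ i]) (use i in auto)
  hence N0: "N \<noteq> 0" "cnj N = N" unfolding N by (simp_all del: of_real_sum)
  have "cnj z = z" using S1 S2 N0 by (metis complex_cnj_mult mult_right_cancel)
  then obtain x where x: "z = complex_of_real x" by (metis Reals_cases Reals_cnj_iff)
  have "poly (char_poly A) x = 0"
    using z[unfolded x of_real_hom.char_poly_hom[OF A]] by simp
  thus ?thesis using eigenvalue_root_char_poly[OF A] by blast
qed

lemma orthogonal_matrix_with_first_column:
  fixes v :: "real vec"
  assumes v: "v \<in> carrier_vec n" and v0: "v \<noteq> 0\<^sub>v n"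
  shows "\<exists>W c. W \<in> carrier_mat n n \<and> W\<^sup>T * W = 1\<^sub>m n \<and> col W 0 = c \<cdot>\<^sub>v v"
proof -
  interpret cof_vec_space n "TYPE(real)" .
  have n: "n \<noteq> 0" using v v0 by (metis carrier_vecD eq_vecI index_zero_vec(2) less_nat_zero_code)
  define b where "b = basis_completion v"
  define ws where "ws = gram_schmidt n b"
  from basis_completion[OF v v0, folded b_def]
  have dist_b: "distinct b" and indep: "\<not> lin_dep (set b)" and b: "set b \<subseteq> carrier_vec n"
    and hdb: "hd b = v" and len_b: "length b = n" by auto
  from hdb len_b n obtain vs where bv: "b = v # vs" by (cases b, auto)
  from gram_schmidt_result[OF b dist_b indep refl, folded ws_def]
  have ws: "set ws \<subseteq> carrier_vec n" "corthogonal ws" "length ws = n" by (auto simp: len_b)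
  from gram_schmidt_hd[OF v, of vs, folded bv] have hdws: "hd ws = v" unfolding ws_def .
  have wsc: "ws ! i \<in> carrier_vec n" if "i < n" for i using ws that by auto
  define c where "c i = 1 / sqrt (ws ! i \<bullet> ws ! i)" for i
  have orth: "(ws ! i \<bullet> ws ! j = 0) = (i \<noteq> j)" if "i < n" "j < n" for i j
    using corthogonalD[OF ws(2), of i j] ws(3) that by simp
  have cc: "c i * (c i * (ws ! i \<bullet> ws ! i)) = 1" if "i < n" for i
  proof -
    have "ws ! i \<bullet> ws ! i \<ge> 0" by (simp add: scalar_prod_def sum_nonneg)
    moreover have "ws ! i \<bullet> ws ! i \<noteq> 0" using orth[OF that that] by simp
    ultimately show ?thesis unfolding c_def by (simp add: field_simps)
  qed
  define W where "W = mat_of_cols n (map (\<lambda>i. c i \<cdot>\<^sub>v ws ! i) [0..<n])"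
  have W: "W \<in> carrier_mat n n" unfolding W_def using mat_of_cols_carrier(1)[of n "map (\<lambda>i. c i \<cdot>\<^sub>v ws ! i) [0..<n]"] by simp
  have colW: "col W i = c i \<cdot>\<^sub>v ws ! i" if "i < n" for i
    unfolding W_def using that wsc[OF that] by (subst col_mat_of_cols) auto
  have "W\<^sup>T * W = 1\<^sub>m n"
  proof (rule eq_matI)
    fix i j assume ij: "i < dim_row (1\<^sub>m n :: real mat)" "j < dim_col (1\<^sub>m n :: real mat)"
    hence ij': "i < n" "j < n" by auto
    have "(W\<^sup>T * W) $$ (i,j) = col W i \<bullet> col W j" using ij' W by simp
    also have "\<dots> = c i * (c j * (ws ! i \<bullet> ws ! j))"
      using ij' wsc[of i] wsc[of j] by (simp add: colW)
    also have "\<dots> = (1\<^sub>m n :: real mat) $$ (i,j)"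
      using orth[OF ij'] cc[OF ij'(1)] ij' by (cases "i = j") auto
    finally show "(W\<^sup>T * W) $$ (i,j) = (1\<^sub>m n :: real mat) $$ (i,j)" .
  qed (use W in auto)
  moreover have "col W 0 = c 0 \<cdot>\<^sub>v v"
    using colW[of 0] n hdws ws(3) by (metis hd_conv_nth length_0_conv neq0_conv)
  ultimately show ?thesis using W by blast
qed

text \<open>
  Induction on the dimension: in an orthonormal basis that starts with an eigenvector, the first column
  vanishes below the diagonal, and by symmetry so does the first row to its right. The remaining block
  is symmetric.
\<close>

theorem real_spectral_theorem:
  fixes A :: "real mat"
  assumes "A \<in> carrier_mat n n" and "A\<^sup>T = A"
  shows "\<exists>U D. U \<in> carrier_mat n n \<and> D \<in> carrier_mat n n \<and> U\<^sup>T * U = 1\<^sub>m n \<and> diagonal_mat D \<and>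
           A = U * D * U\<^sup>T"
  using assms
proof (induction n arbitrary: A)
  case 0
  show ?case
    by (rule exI[of _ "1\<^sub>m 0"], rule exI[of _ "1\<^sub>m 0"]) (use 0 in \<open>auto simp: diagonal_mat_def\<close>)
next
  case (Suc m)
  note A = Suc.prems(1) and sym = Suc.prems(2)
  obtain x where "eigenvalue A x" using symmetric_real_eigenvalue[OF A sym] by auto
  then obtain v where v: "v \<in> carrier_vec (Suc m)" "v \<noteq> 0\<^sub>v (Suc m)" "A *\<^sub>v v = x \<cdot>\<^sub>v v"
    using A unfolding eigenvalue_def eigenvector_def by auto
  obtain W c where W: "W \<in> carrier_mat (Suc m) (Suc m)" "W\<^sup>T * W = 1\<^sub>m (Suc m)" "col W 0 = c \<cdot>\<^sub>v v"
    using orthogonal_matrix_with_first_column[OF v(1,2)] by blast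
  have WT: "W\<^sup>T \<in> carrier_mat (Suc m) (Suc m)" using W by simp
  have WWT: "W * W\<^sup>T = 1\<^sub>m (Suc m)" using mat_mult_left_right_inverse[OF WT W(1) W(2)] .
  define B where "B = W\<^sup>T * A * W"
  have B: "B \<in> carrier_mat (Suc m) (Suc m)" unfolding B_def using W A by simp
  have Bsym: "B\<^sup>T = B"
    unfolding B_def using W(1) WT A sym
    by (simp add: transpose_mult[of _ "Suc m" "Suc m" _ "Suc m"] assoc_mult_mat[of _ "Suc m" "Suc m" _ "Suc m" _ "Suc m"])
  have B_entry: "B $$ (i,j) = B $$ (j,i)" if "i < Suc m" "j < Suc m" for i j
    using arg_cong[OF Bsym, of "\<lambda>M. M $$ (j,i)"] that B by simp
  have col0: "B $$ (i,0) = (if i = 0 then x else 0)" if i: "i < Suc m" for i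
  proof -
    have "B $$ (i,0) = row (W\<^sup>T) i \<bullet> col (A * W) 0"
      unfolding B_def using W A i WT by (simp add: assoc_mult_mat[of _ "Suc m" "Suc m" _ "Suc m" _ "Suc m"])
    also have "col (A * W) 0 = A *\<^sub>v col W 0" using A W(1) by auto
    also have "\<dots> = x \<cdot>\<^sub>v col W 0" unfolding W(3)
      using v A by (simp add: mult_mat_vec smult_smult_assoc mult.commute)
    also have "row (W\<^sup>T) i \<bullet> (x \<cdot>\<^sub>v col W 0) = x * (row (W\<^sup>T) i \<bullet> col W 0)"
      using W(1) i by (subst scalar_prod_smult_distrib[of _ "Suc m"]) (auto intro!: carrier_vecI)
    also have "row (W\<^sup>T) i \<bullet> col W 0 = (W\<^sup>T * W) $$ (i, 0)" using W(1) i by simp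
    also have "\<dots> = (if i = 0 then 1 else 0)" using W i by simp
    finally show ?thesis by simp
  qed
  define B3 where "B3 = Matrix.mat m m (\<lambda>(i,j). B $$ (Suc i, Suc j))"
  have B3: "B3 \<in> carrier_mat m m" unfolding B3_def by simp
  have "B3\<^sup>T = B3" by (rule eq_matI) (auto simp: B3_def B_entry)
  from Suc.IH[OF B3 this] obtain U D where UD: "U \<in> carrier_mat m m" "D \<in> carrier_mat m m"
    "U\<^sup>T * U = 1\<^sub>m m" "diagonal_mat D" "B3 = U * D * U\<^sup>T" by blast
  let ?F = "\<lambda>p M. four_block_mat p (0\<^sub>m 1 m) (0\<^sub>m m 1) M"
  let ?x = "Matrix.mat 1 1 (\<lambda>_. x)"
  have Bblock: "B = ?F ?x B3"
  proof (rule eq_matI)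
    fix i j assume "i < dim_row (?F ?x B3)" "j < dim_col (?F ?x B3)"
    hence ij: "i < Suc m" "j < Suc m" using B3 by auto
    show "B $$ (i,j) = ?F ?x B3 $$ (i,j)"
      using ij col0[of i] col0[of j] B_entry[of i j] B3
      by (cases i; cases j) (auto simp: B3_def)
  qed (use B B3 in auto)
  define V where "V = ?F (1\<^sub>m 1) U"
  define E where "E = ?F ?x D"
  have V: "V \<in> carrier_mat (Suc m) (Suc m)" unfolding V_def using UD by auto
  have E: "E \<in> carrier_mat (Suc m) (Suc m)" unfolding E_def using UD by auto
  have VT: "V\<^sup>T = ?F (1\<^sub>m 1) (U\<^sup>T)" unfolding V_def
    by (subst transpose_four_block_mat[of _ 1 1 _ m _ m]) (use UD in auto)
  have VTV: "V\<^sup>T * V = 1\<^sub>m (Suc m)"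
    unfolding VT unfolding V_def using UD
    by (subst mult_four_block_mat[of _ 1 1 _ m _ m _ _ 1 _ m]) (auto simp: four_block_one_mat)
  have VE: "V * E = ?F ?x (U * D)" unfolding V_def E_def
    using UD by (subst mult_four_block_mat[of _ 1 1 _ m _ m _ _ 1 _ m]) auto
  have VEV: "V * E * V\<^sup>T = B" unfolding Bblock VE VT UD(5)
    using UD by (subst mult_four_block_mat[of _ 1 1 _ m _ m _ _ 1 _ m]) auto
  have diagE: "diagonal_mat E" unfolding E_def diagonal_mat_def
    using UD(2,4) by (auto simp: diagonal_mat_def)
  have VTc: "V\<^sup>T \<in> carrier_mat (Suc m) (Suc m)" using V by simp
  note assoc = assoc_mult_mat[of _ "Suc m" "Suc m" _ "Suc m" _ "Suc m"]
  note tr = transpose_mult[of _ "Suc m" "Suc m" _ "Suc m"]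
  have "A = (W * W\<^sup>T) * A * (W * W\<^sup>T)" using WWT A by simp
  also have "\<dots> = W * B * W\<^sup>T" unfolding B_def using W(1) WT A by (simp add: assoc)
  also have "\<dots> = (W * V) * E * (W * V)\<^sup>T"
    unfolding VEV[symmetric] using W(1) WT V VTc E by (simp add: assoc tr)
  finally have 1: "A = (W * V) * E * (W * V)\<^sup>T" .
  have "(W * V)\<^sup>T * (W * V) = V\<^sup>T * (W\<^sup>T * W) * V" using W(1) WT V VTc by (simp add: assoc tr)
  also have "\<dots> = 1\<^sub>m (Suc m)" using W(2) VTV VTc by simp
  finally show ?case using 1 W(1) V E diagE by (metis mult_carrier_mat)
qed


lemma mult_transpose_entry:
  assumes "M \<in> carrier_mat n n" "U \<in> carrier_mat n n" "i < n" "j < n"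
  shows "(M * U\<^sup>T) $$ (i,j) = (\<Sum>k<n. M $$ (i,k) * U $$ (j,k))"
  using assms by (simp add: scalar_prod_def lessThan_atLeast0)

lemma spectral_decomposition_exists:
  assumes "\<And>i j. i < n \<Longrightarrow> j < n \<Longrightarrow> a i j = a j i"
  shows "\<exists>l u. spectral n a l u"
proof -
  define A where "A = Matrix.mat n n (\<lambda>(i,j). a i j)"
  have A: "A \<in> carrier_mat n n" unfolding A_def by simp
  have "A\<^sup>T = A" unfolding A_def by (rule eq_matI) (auto simp: assms)
  from real_spectral_theorem[OF A this] obtain U D where UD: "U \<in> carrier_mat n n" "D \<in> carrier_mat n n"
    "U\<^sup>T * U = 1\<^sub>m n" "diagonal_mat D" "A = U * D * U\<^sup>T" by blast
  have UUT: "U * U\<^sup>T = 1\<^sub>m n" using mat_mult_left_right_inverse[OF _ UD(1) UD(3)] UD(1) by simp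
  define u where "u k i = U $$ (i,k)" for k i
  define l where "l k = D $$ (k,k)" for k
  have "(\<Sum>i<n. u k i * u j i) = (if k = j then 1 else 0)" if "k < n" "j < n" for k j
  proof -
    have "(\<Sum>i<n. u k i * u j i) = (U\<^sup>T * U) $$ (k,j)"
      using that UD(1) by (simp add: scalar_prod_def lessThan_atLeast0 u_def)
    thus ?thesis using UD(3) that by simp
  qed
  moreover have "(\<Sum>k<n. u k i * u k j) = (if i = j then 1 else 0)" if "i < n" "j < n" for i j
  proof -
    have "(\<Sum>k<n. u k i * u k j) = (U * U\<^sup>T) $$ (i,j)"
      using that UD(1) by (simp add: scalar_prod_def lessThan_atLeast0 u_def)
    thus ?thesis using UUT that by simp
  qed
  moreover have "a i j = (\<Sum>k<n. l k * u k i * u k j)" if "i < n" "j < n" for i j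
  proof -
    have UDe: "(U * D) $$ (i,k) = l k * u k i" if "k < n" for k
    proof -
      have "(U * D) $$ (i,k) = (\<Sum>h<n. U $$ (i,h) * D $$ (h,k))"
        using \<open>i < n\<close> that UD(1,2) by (simp add: scalar_prod_def lessThan_atLeast0)
      also have "\<dots> = (\<Sum>h<n. if h = k then U $$ (i,k) * D $$ (k,k) else 0)"
        using UD(2,4) that by (intro sum.cong refl) (auto simp: diagonal_mat_def)
      finally show ?thesis using that by (simp add: u_def l_def)
    qed
    have "a i j = A $$ (i,j)" using that by (simp add: A_def)
    also have "\<dots> = (U * D * U\<^sup>T) $$ (i,j)" using UD(5) by simp
    also have "\<dots> = (\<Sum>k<n. (U * D) $$ (i,k) * U $$ (j,k))"
      using that UD(1,2) by (intro mult_transpose_entry) auto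
    also have "\<dots> = (\<Sum>k<n. l k * u k i * u k j)" by (simp add: UDe u_def)
    finally show ?thesis .
  qed
  ultimately show ?thesis unfolding spectral_def orthonormal_family_def by blast
qed

section \<open>The energy as a norm\<close>

definition array_energy :: "nat \<Rightarrow> (nat \<Rightarrow> nat \<Rightarrow> real) \<Rightarrow> real" where
  "array_energy n a = energy (Matrix.mat n n (\<lambda>(i, j). a i j))"

text \<open>
  Any spectral decomposition computes the energy, because similarity preserves the characteristic
  polynomial.
\<close>

lemma array_energy_spectral:
  assumes sp: "spectral n a l u"
  shows "array_energy n a = (\<Sum>k<n. \<bar>l k\<bar>)"
proof -
  define A where "A = Matrix.mat n n (\<lambda>(i,j). a i j)"
  define U where "U = Matrix.mat n n (\<lambda>(i,k). u k i)"
  define D where "D = Matrix.mat n n (\<lambda>(i,j). if i = j then l i else 0)"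
  have c: "A \<in> carrier_mat n n" "U \<in> carrier_mat n n" "D \<in> carrier_mat n n"
    unfolding A_def U_def D_def by auto
  have orth: "\<And>k l. k < n \<Longrightarrow> l < n \<Longrightarrow> (\<Sum>i<n. u k i * u l i) = (if k = l then 1 else 0)"
    and compl: "\<And>i j. i < n \<Longrightarrow> j < n \<Longrightarrow> (\<Sum>k<n. u k i * u k j) = (if i = j then 1 else 0)"
    and a: "\<And>i j. i < n \<Longrightarrow> j < n \<Longrightarrow> a i j = (\<Sum>k<n. l k * u k i * u k j)"
    using sp unfolding spectral_def orthonormal_family_def by auto
  have UTU: "U\<^sup>T * U = 1\<^sub>m n"
    by (rule eq_matI) (auto simp: U_def scalar_prod_def lessThan_atLeast0[symmetric] orth)
  have UUT: "U * U\<^sup>T = 1\<^sub>m n"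
    by (rule eq_matI) (auto simp: U_def scalar_prod_def lessThan_atLeast0[symmetric] compl)
  have UDe: "(U * D) $$ (i,k) = l k * u k i" if "i < n" "k < n" for i k
  proof -
    have "(U * D) $$ (i,k) = (\<Sum>h<n. u h i * (if h = k then l h else 0))"
      using that by (simp add: scalar_prod_def lessThan_atLeast0 U_def D_def)
    also have "\<dots> = (\<Sum>h<n. if h = k then u k i * l k else 0)"
      by (intro sum.cong refl) auto
    finally show ?thesis using that by simp
  qed
  have "A = U * D * U\<^sup>T"
  proof (rule eq_matI)
    fix i j assume "i < dim_row (U * D * U\<^sup>T)" "j < dim_col (U * D * U\<^sup>T)"
    hence ij: "i < n" "j < n" using c by auto
    have "(U * D * U\<^sup>T) $$ (i,j) = (\<Sum>k<n. (U * D) $$ (i,k) * U $$ (j,k))"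
      using ij c by (intro mult_transpose_entry) auto
    also have "\<dots> = (\<Sum>k<n. l k * u k i * u k j)"
      using ij by (intro sum.cong refl) (simp add: UDe, simp add: U_def)
    finally show "A $$ (i,j) = (U * D * U\<^sup>T) $$ (i,j)" using a[OF ij] ij by (simp add: A_def)
  qed (use c in auto)
  hence "similar_mat A D"
    unfolding similar_mat_def
    by (intro exI[of _ U] exI[of _ "U\<^sup>T"] similar_mat_witI[of _ _ n]) (use c UTU UUT in auto)
  hence "char_poly A = char_poly D" by (rule char_poly_similar)
  also have "\<dots> = (\<Prod>d\<leftarrow>diag_mat D. [:- d, 1:])"
    by (rule char_poly_upper_triangular[OF c(3)]) (auto simp: D_def upper_triangular_def)
  also have "diag_mat D = map l [0..<n]"
    unfolding diag_mat_def D_def by (auto intro: map_cong)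
  also have "(\<Prod>d\<leftarrow>map l [0..<n]. [:- d, 1:]) = (\<Prod>k<n. [:- l k, 1:])"
    using prod.distinct_set_conv_list[of "[0..<n]" "\<lambda>k. [:- l k, 1:]"]
    by (simp add: o_def lessThan_atLeast0)
  finally have "char_poly A = (\<Prod>k<n. [:- l k, 1:])" .
  hence "proots (char_poly A) = (\<Sum>k<n. {#l k#})"
    by (simp add: proots_prod)
  moreover have "(\<Sum>x\<in>#(\<Sum>k\<in>K. {#l k#}). \<bar>x\<bar>) = (\<Sum>k\<in>K. \<bar>l k\<bar>)" if "finite K" for K
    using that by (induction K rule: finite_induct) auto
  ultimately show ?thesis unfolding array_energy_def energy_def A_def[symmetric] by simp
qed

lemma spectral_eigenvector:
  assumes sp: "spectral n a l u" and "k < n" "i < n"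
  shows "(\<Sum>j<n. a i j * u k j) = l k * u k i"
proof -
  have orth: "\<And>k l. k < n \<Longrightarrow> l < n \<Longrightarrow> (\<Sum>i<n. u k i * u l i) = (if k = l then 1 else 0)"
    and a: "\<And>i j. i < n \<Longrightarrow> j < n \<Longrightarrow> a i j = (\<Sum>k<n. l k * u k i * u k j)"
    using sp unfolding spectral_def orthonormal_family_def by auto
  have "(\<Sum>j<n. a i j * u k j) = (\<Sum>j<n. \<Sum>h<n. l h * u h i * (u h j * u k j))"
    using assms(3) by (intro sum.cong refl) (auto simp: a sum_distrib_right sum_distrib_left mult_ac)
  also have "\<dots> = (\<Sum>h<n. l h * u h i * (\<Sum>j<n. u h j * u k j))"
    by (subst sum.swap) (simp add: sum_distrib_left)
  also have "\<dots> = (\<Sum>h<n. if h = k then l k * u k i else 0)"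
    using assms(2) by (intro sum.cong refl) (auto simp: orth)
  finally show ?thesis using assms(2) by simp
qed

lemma spectral_quadratic_form:
  assumes sp: "spectral n a l u" and "k < n"
  shows "(\<Sum>i<n. \<Sum>j<n. u k i * a i j * u k j) = l k"
proof -
  have orth: "(\<Sum>i<n. u k i * u k i) = 1"
    using sp assms(2) unfolding spectral_def orthonormal_family_def by auto
  have "(\<Sum>i<n. \<Sum>j<n. u k i * a i j * u k j) = (\<Sum>i<n. u k i * (\<Sum>j<n. a i j * u k j))"
    by (simp add: sum_distrib_left mult.assoc)
  also have "\<dots> = (\<Sum>i<n. u k i * (l k * u k i))"
    by (intro sum.cong refl) (simp add: spectral_eigenvector[OF sp assms(2)])
  also have "\<dots> = l k * (\<Sum>i<n. u k i * u k i)" by (simp add: sum_distrib_left mult_ac)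
  finally show ?thesis using orth by simp
qed

lemma spectral_frobenius:
  assumes sp: "spectral n a l u"
  shows "(\<Sum>i<n. \<Sum>j<n. (a i j)\<^sup>2) = (\<Sum>k<n. (l k)\<^sup>2)"
proof -
  have orth: "\<And>k. k < n \<Longrightarrow> (\<Sum>i<n. u k i * u k i) = 1"
    and a: "\<And>i j. i < n \<Longrightarrow> j < n \<Longrightarrow> a i j = (\<Sum>k<n. l k * u k i * u k j)"
    using sp unfolding spectral_def orthonormal_family_def by auto
  have "(\<Sum>i<n. \<Sum>j<n. (a i j)\<^sup>2) = (\<Sum>i<n. \<Sum>j<n. \<Sum>k<n. l k * u k i * (a i j * u k j))"
  proof (intro sum.cong refl)
    fix i j assume "i \<in> {..<n}" "j \<in> {..<n}"
    hence "(a i j)\<^sup>2 = a i j * (\<Sum>k<n. l k * u k i * u k j)" using a[of i j] by (simp add: power2_eq_square)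
    thus "(a i j)\<^sup>2 = (\<Sum>k<n. l k * u k i * (a i j * u k j))" by (simp add: sum_distrib_left mult_ac)
  qed
  also have "\<dots> = (\<Sum>i<n. \<Sum>k<n. l k * u k i * (\<Sum>j<n. a i j * u k j))"
    by (rule sum.cong[OF refl]) (subst sum.swap, simp add: sum_distrib_left)
  also have "\<dots> = (\<Sum>i<n. \<Sum>k<n. (l k)\<^sup>2 * (u k i * u k i))"
    by (intro sum.cong refl) (simp add: spectral_eigenvector[OF sp] power2_eq_square mult_ac)
  also have "\<dots> = (\<Sum>k<n. (l k)\<^sup>2 * (\<Sum>i<n. u k i * u k i))"
    by (subst sum.swap) (simp add: sum_distrib_left)
  finally show ?thesis using orth by simp
qed

text \<open>
  The \<open>k\<close>-th form is the sum of \<open>m\<^sub>h \<langle>v\<^sub>h, u\<^sub>k\<rangle>\<^sup>2\<close> over \<open>h\<close>, and the weights of each eigenvalue \<open>m\<^sub>h\<close> sum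
  to one over \<open>k\<close>. Applied in the eigenbasis of a sum \<open>b + c\<close>, this bound gives the triangle
  inequality.
\<close>

lemma sum_quadratic_forms_le_energy:
  assumes sp: "spectral n b m v" and u: "orthonormal_family n u"
  shows "(\<Sum>k<n. \<bar>\<Sum>i<n. \<Sum>j<n. u k i * b i j * u k j\<bar>) \<le> (\<Sum>h<n. \<bar>m h\<bar>)"
proof -
  have orth: "\<And>k. k < n \<Longrightarrow> (\<Sum>i<n. v k i * v k i) = 1"
    and b: "\<And>i j. i < n \<Longrightarrow> j < n \<Longrightarrow> b i j = (\<Sum>k<n. m k * v k i * v k j)"
    using sp unfolding spectral_def orthonormal_family_def by auto
  have compl: "\<And>i j. i < n \<Longrightarrow> j < n \<Longrightarrow> (\<Sum>k<n. u k i * u k j) = (if i = j then 1 else 0)"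
    using u unfolding orthonormal_family_def by auto
  define s where "s h k = (\<Sum>i<n. v h i * u k i)" for h k
  have form: "(\<Sum>i<n. \<Sum>j<n. u k i * b i j * u k j) = (\<Sum>h<n. m h * (s h k)\<^sup>2)" for k
  proof -
    have "(\<Sum>i<n. \<Sum>j<n. u k i * b i j * u k j) =
        (\<Sum>i<n. \<Sum>j<n. \<Sum>h<n. m h * ((v h i * u k i) * (v h j * u k j)))"
      by (intro sum.cong refl) (simp add: b sum_distrib_left sum_distrib_right mult_ac)
    also have "\<dots> = (\<Sum>i<n. \<Sum>h<n. \<Sum>j<n. m h * ((v h i * u k i) * (v h j * u k j)))"
      by (rule sum.cong[OF refl]) (rule sum.swap)
    also have "\<dots> = (\<Sum>h<n. \<Sum>i<n. \<Sum>j<n. m h * ((v h i * u k i) * (v h j * u k j)))"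
      by (rule sum.swap)
    also have "\<dots> = (\<Sum>h<n. m h * (s h k)\<^sup>2)"
      by (rule sum.cong[OF refl]) (simp only: s_def power2_eq_square sum_product, simp only: sum_distrib_left)
    finally show ?thesis .
  qed
  have parseval: "(\<Sum>k<n. (s h k)\<^sup>2) = 1" if "h < n" for h
  proof -
    have "(\<Sum>k<n. (s h k)\<^sup>2) = (\<Sum>k<n. \<Sum>i<n. \<Sum>j<n. v h i * v h j * (u k i * u k j))"
      by (simp add: s_def power2_eq_square sum_product mult_ac)
    also have "\<dots> = (\<Sum>i<n. \<Sum>k<n. \<Sum>j<n. v h i * v h j * (u k i * u k j))"
      by (rule sum.swap)
    also have "\<dots> = (\<Sum>i<n. \<Sum>j<n. \<Sum>k<n. v h i * v h j * (u k i * u k j))"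
      by (rule sum.cong[OF refl]) (rule sum.swap)
    also have "\<dots> = (\<Sum>i<n. \<Sum>j<n. if i = j then v h i * v h i else 0)"
      by (intro sum.cong refl) (auto simp: sum_distrib_left[symmetric] compl)
    finally show ?thesis using orth[OF that] by simp
  qed
  have "(\<Sum>k<n. \<bar>\<Sum>i<n. \<Sum>j<n. u k i * b i j * u k j\<bar>) \<le> (\<Sum>k<n. \<Sum>h<n. \<bar>m h\<bar> * (s h k)\<^sup>2)"
    unfolding form by (intro sum_mono order_trans[OF sum_abs]) (simp add: abs_mult)
  also have "\<dots> = (\<Sum>h<n. \<bar>m h\<bar> * (\<Sum>k<n. (s h k)\<^sup>2))"
    by (subst sum.swap) (simp add: sum_distrib_left)
  finally show ?thesis by (simp add: parseval)
qed

lemma array_energy_triangle: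
  assumes "\<And>i j. i < n \<Longrightarrow> j < n \<Longrightarrow> b i j = b j i"
    and "\<And>i j. i < n \<Longrightarrow> j < n \<Longrightarrow> c i j = c j i"
    and a: "\<And>i j. i < n \<Longrightarrow> j < n \<Longrightarrow> a i j = b i j + c i j"
  shows "array_energy n a \<le> array_energy n b + array_energy n c"
proof -
  obtain m v where b: "spectral n b m v" using spectral_decomposition_exists assms(1) by blast
  obtain r w where c: "spectral n c r w" using spectral_decomposition_exists assms(2) by blast
  have "a i j = a j i" if "i < n" "j < n" for i j using a that assms(1,2) by simp
  then obtain l u where sa: "spectral n a l u" using spectral_decomposition_exists by blast
  hence u: "orthonormal_family n u" unfolding spectral_def by simp
  define B where "B k = (\<Sum>i<n. \<Sum>j<n. u k i * b i j * u k j)" for k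
  define C where "C k = (\<Sum>i<n. \<Sum>j<n. u k i * c i j * u k j)" for k
  have "l k = B k + C k" if "k < n" for k
    unfolding spectral_quadratic_form[OF sa that, symmetric] B_def C_def sum.distrib[symmetric]
    by (intro sum.cong refl) (simp add: a algebra_simps)
  hence "array_energy n a = (\<Sum>k<n. \<bar>B k + C k\<bar>)" by (simp add: array_energy_spectral[OF sa])
  also have "\<dots> \<le> (\<Sum>k<n. \<bar>B k\<bar> + \<bar>C k\<bar>)" by (intro sum_mono abs_triangle_ineq)
  also have "\<dots> = (\<Sum>k<n. \<bar>B k\<bar>) + (\<Sum>k<n. \<bar>C k\<bar>)" by (rule sum.distrib)
  also have "\<dots> \<le> array_energy n b + array_energy n c"
    unfolding array_energy_spectral[OF b] array_energy_spectral[OF c] B_def C_def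
    by (intro add_mono sum_quadratic_forms_le_energy[OF b u] sum_quadratic_forms_le_energy[OF c u])
  finally show ?thesis .
qed

lemma array_energy_scale:
  assumes "\<And>i j. i < n \<Longrightarrow> j < n \<Longrightarrow> a i j = a j i"
  shows "array_energy n (\<lambda>i j. t * a i j) = \<bar>t\<bar> * array_energy n a"
proof -
  obtain l u where sa: "spectral n a l u" using spectral_decomposition_exists assms by blast
  hence "spectral n (\<lambda>i j. t * a i j) (\<lambda>k. t * l k) u"
    unfolding spectral_def by (auto simp: sum_distrib_left mult_ac)
  thus ?thesis using sa
    by (simp add: array_energy_spectral abs_mult sum_distrib_left)
qed

lemma array_energy_le_frobenius:
  assumes "\<And>i j. i < n \<Longrightarrow> j < n \<Longrightarrow> a i j = a j i"
  shows "array_energy n a \<le> sqrt (real n) * sqrt (\<Sum>i<n. \<Sum>j<n. (a i j)\<^sup>2)"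
proof -
  obtain l u where sa: "spectral n a l u" using spectral_decomposition_exists assms by blast
  have "(\<Sum>k<n. 1 * \<bar>l k\<bar>)\<^sup>2 \<le> (\<Sum>k<n. 1\<^sup>2) * (\<Sum>k<n. \<bar>l k\<bar>\<^sup>2)"
    by (rule Cauchy_Schwarz_ineq_sum)
  hence "(array_energy n a)\<^sup>2 \<le> real n * (\<Sum>i<n. \<Sum>j<n. (a i j)\<^sup>2)"
    by (simp add: array_energy_spectral[OF sa] spectral_frobenius[OF sa])
  thus ?thesis by (simp add: real_le_rsqrt real_sqrt_mult[symmetric])
qed

text \<open>
  The eigenvalues are values \<open>(\<Sum>\<^sub>i u\<^sub>i)\<^sup>2 \<ge> 0\<close> of the quadratic form, so the energy is the trace.
\<close>

lemma array_energy_ones: "array_energy n (\<lambda>_ _. 1) = real n"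
proof -
  obtain l u where sa: "spectral n (\<lambda>_ _. 1) l u"
    using spectral_decomposition_exists[of n "\<lambda>_ _. 1"] by auto
  have orth: "\<And>k. k < n \<Longrightarrow> (\<Sum>i<n. u k i * u k i) = 1"
    and one: "\<And>i j. i < n \<Longrightarrow> j < n \<Longrightarrow> 1 = (\<Sum>k<n. l k * u k i * u k j)"
    using sa unfolding spectral_def orthonormal_family_def by auto
  have "l k \<ge> 0" if "k < n" for k
  proof -
    have "l k = (\<Sum>i<n. u k i)\<^sup>2"
      using spectral_quadratic_form[OF sa that] by (simp add: power2_eq_square sum_product)
    thus ?thesis by simp
  qed
  hence "array_energy n (\<lambda>_ _. 1) = (\<Sum>k<n. l k * (\<Sum>i<n. u k i * u k i))"
    by (simp add: array_energy_spectral[OF sa] orth)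
  also have "\<dots> = (\<Sum>i<n. \<Sum>k<n. l k * u k i * u k i)"
    by (simp add: sum_distrib_left mult_ac) (rule sum.swap)
  also have "\<dots> = (\<Sum>i<n. 1)" by (intro sum.cong refl one[symmetric]) auto
  finally show ?thesis by simp
qed

section \<open>Independent coins\<close>

abbreviation coins :: "'a set \<Rightarrow> real \<Rightarrow> ('a \<Rightarrow> bool) pmf" where
  "coins A p \<equiv> Pi_pmf A False (\<lambda>_. bernoulli_pmf p)"

lemma finite_set_pmf_coins: "finite A \<Longrightarrow> finite (set_pmf (coins A p))"
  by (rule finite_subset[OF set_Pi_pmf_subset' finite_PiE_dflt]) auto

lemma integrable_coins:
  fixes f :: "_ \<Rightarrow> 'b :: {banach, second_countable_topology}"
  shows "finite A \<Longrightarrow> integrable (measure_pmf (coins A p)) f"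
  by (rule integrable_measure_pmf_finite[OF finite_set_pmf_coins])

lemma expectation_coins_insert:
  fixes f :: "('a \<Rightarrow> bool) \<Rightarrow> 'b :: {banach, second_countable_topology}"
  assumes A: "finite A" "e \<notin> A" and p: "0 \<le> p" "p \<le> 1"
  shows "measure_pmf.expectation (coins (insert e A) p) f =
    measure_pmf.expectation (coins A p) (\<lambda>w. p *\<^sub>R f (w(e := True)) + (1 - p) *\<^sub>R f (w(e := False)))"
proof -
  let ?S = "set_pmf (coins A p)"
  have fin: "finite ?S" by (rule finite_set_pmf_coins[OF A(1)])
  have "coins (insert e A) p = coins A p \<bind> (\<lambda>w. map_pmf (\<lambda>b. w(e := b)) (bernoulli_pmf p))"
    unfolding Pi_pmf_insert'[OF A] map_pmf_def by (rule bind_commute_pmf)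
  hence "measure_pmf.expectation (coins (insert e A) p) f =
    (\<Sum>w\<in>?S. pmf (coins A p) w *\<^sub>R measure_pmf.expectation (map_pmf (\<lambda>b. w(e := b)) (bernoulli_pmf p)) f)"
    using fin by (simp only:) (rule pmf_expectation_bind, auto)
  also have "\<dots> = (\<Sum>w\<in>?S. pmf (coins A p) w *\<^sub>R (p *\<^sub>R f (w(e := True)) + (1 - p) *\<^sub>R f (w(e := False))))"
    using p by (simp add: integral_measure_pmf[of UNIV] UNIV_bool add.commute)
  also have "\<dots> = measure_pmf.expectation (coins A p) (\<lambda>w. p *\<^sub>R f (w(e := True)) + (1 - p) *\<^sub>R f (w(e := False)))"
    by (rule integral_measure_pmf[symmetric]) (use fin in auto)
  finally show ?thesis .
qed

text \<open>
  A discrete Stein identity. It is exact because the coin takes the values \<open>1\<close> and \<open>0\<close> with weights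
  \<open>p\<close> and \<open>1 - p\<close>, so that both outcomes contribute the same multiple \<open>p (1 - p)\<close> of \<open>f\<close>, with
  opposite signs.
\<close>

lemma coins_integration_by_parts:
  fixes f :: "('a \<Rightarrow> bool) \<Rightarrow> 'b :: {banach, second_countable_topology}"
  assumes A: "finite A" "e \<in> A" and p: "0 \<le> p" "p \<le> 1"
  shows "measure_pmf.expectation (coins A p) (\<lambda>w. (of_bool (w e) - p) *\<^sub>R f w) =
    (p * (1 - p)) *\<^sub>R measure_pmf.expectation (coins A p) (\<lambda>w. f (w(e := True)) - f (w(e := False)))"
proof -
  define B where "B = A - {e}"
  have B: "finite B" "e \<notin> B" "A = insert e B" using A by (auto simp: B_def)
  have l: "p *\<^sub>R ((of_bool ((w(e := True)) e) - p) *\<^sub>R f (w(e := True))) +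
      (1 - p) *\<^sub>R ((of_bool ((w(e := False)) e) - p) *\<^sub>R f (w(e := False))) =
      (p * (1 - p)) *\<^sub>R (f (w(e := True)) - f (w(e := False)))" for w
    by (simp add: scaleR_diff_right mult.commute)
  have r: "p *\<^sub>R (f (w(e := True, e := True)) - f (w(e := True, e := False))) +
      (1 - p) *\<^sub>R (f (w(e := False, e := True)) - f (w(e := False, e := False))) =
      f (w(e := True)) - f (w(e := False))" for w
    by (simp add: scaleR_add_left[symmetric])
  show ?thesis
    unfolding B(3) expectation_coins_insert[OF B(1,2) p] l r by (rule integral_scaleR_right)
qed

lemma expectation_two_coins:
  assumes A: "finite A" "e \<in> A" "e' \<in> A" "e \<noteq> e'" and p: "0 \<le> p" "p \<le> 1"
  shows "measure_pmf.expectation (coins A p) (\<lambda>w. of_bool (w e) * of_bool (w e')) = p\<^sup>2"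
proof -
  note [simp] = integrable_coins[OF A(1)]
  have 1: "measure_pmf.expectation (coins A p) (\<lambda>w. of_bool (w e')) = p"
    using coins_integration_by_parts[OF A(1,3) p, of "\<lambda>_. 1 :: real"] by simp
  show ?thesis
    using coins_integration_by_parts[OF A(1,2) p, of "\<lambda>w. of_bool (w e') :: real"] A(4) 1
    by (simp add: left_diff_distrib power2_eq_square)
qed

text \<open>
  Adding one coin splits the second moment about \<open>m\<close> into \<open>p (1 - p)\<close> times the squared influence of
  that coin and the second moment of the average \<open>g\<close> over it. The average has the same mean and no
  larger influences, so induction applies to \<open>g\<close>.
\<close>

lemma efron_stein_coins:
  fixes f :: "('a \<Rightarrow> bool) \<Rightarrow> 'b :: {real_inner, banach, second_countable_topology}"
  assumes "finite A" and p: "0 \<le> p" "p \<le> 1"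
    and "\<And>w e. e \<in> A \<Longrightarrow> norm (f (w(e := True)) - f (w(e := False))) \<le> c e"
  shows "measure_pmf.expectation (coins A p)
     (\<lambda>w. (norm (f w - measure_pmf.expectation (coins A p) f))\<^sup>2) \<le> (\<Sum>e\<in>A. (c e)\<^sup>2)"
  using assms(1,4)
proof (induction A arbitrary: f rule: finite_induct)
  case empty
  show ?case by simp
next
  case (insert e A)
  note [simp] = integrable_coins[OF insert.hyps(1)]
  define g where "g w = p *\<^sub>R f (w(e := True)) + (1 - p) *\<^sub>R f (w(e := False))" for w
  define m where "m = measure_pmf.expectation (coins (insert e A) p) f"
  have m: "m = measure_pmf.expectation (coins A p) g"
    unfolding m_def g_def by (rule expectation_coins_insert[OF insert.hyps p])
  have split: "p *\<^sub>R (norm (a - m))\<^sup>2 + (1 - p) *\<^sub>R (norm (b - m))\<^sup>2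
      = p * (1 - p) * (norm (a - b))\<^sup>2 + (norm (p *\<^sub>R a + (1 - p) *\<^sub>R b - m))\<^sup>2" for a b
  proof -
    define x y where "x = a - m" and "y = b - m"
    have 1: "a - b = x - y" "p *\<^sub>R a + (1 - p) *\<^sub>R b - m = p *\<^sub>R x + (1 - p) *\<^sub>R y"
      unfolding x_def y_def by (simp_all add: algebra_simps)
    show ?thesis
      unfolding 1 x_def[symmetric] y_def[symmetric] power2_norm_eq_inner inner_diff_left inner_diff_right
        inner_add_left inner_add_right inner_scaleR_left inner_scaleR_right inner_commute[of y x]
      by (simp add: algebra_simps)
  qed
  have gdiff: "norm (g (w(d := True)) - g (w(d := False))) \<le> c d" if d: "d \<in> A" for w d
  proof -
    have ne: "d \<noteq> e" using d insert.hyps by auto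
    define x where "x = f ((w(e := True))(d := True)) - f ((w(e := True))(d := False))"
    define y where "y = f ((w(e := False))(d := True)) - f ((w(e := False))(d := False))"
    have nx: "norm x \<le> c d" "norm y \<le> c d"
      unfolding x_def y_def using d by (intro insert.prems insertI2; assumption)+
    have "g (w(d := True)) - g (w(d := False)) = p *\<^sub>R x + (1 - p) *\<^sub>R y"
      unfolding g_def x_def y_def fun_upd_twist[OF ne] by (simp add: algebra_simps)
    also have "norm \<dots> \<le> p * norm x + (1 - p) * norm y"
      using p by (intro order_trans[OF norm_triangle_ineq]) simp
    also have "\<dots> \<le> p * c d + (1 - p) * c d"
      using p nx by (intro add_mono mult_left_mono) auto
    finally show ?thesis by (simp add: algebra_simps)
  qed
  have first: "p * (1 - p) * (norm (f (w(e := True)) - f (w(e := False))))\<^sup>2 \<le> (c e)\<^sup>2" for w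
  proof -
    have "(norm (f (w(e := True)) - f (w(e := False))))\<^sup>2 \<le> (c e)\<^sup>2"
      by (intro power_mono insert.prems insertI1 norm_ge_zero)
    moreover have "p * (1 - p) \<le> 1" using p by (intro mult_le_one) auto
    ultimately show ?thesis using p
      by (metis (no_types, lifting) diff_ge_0_iff_ge mult_left_le_one_le mult_nonneg_nonneg order_trans zero_le_power2)
  qed
  have "measure_pmf.expectation (coins (insert e A) p) (\<lambda>w. (norm (f w - m))\<^sup>2) =
      measure_pmf.expectation (coins A p) (\<lambda>w. p * (1 - p) * (norm (f (w(e := True)) - f (w(e := False))))\<^sup>2 + (norm (g w - m))\<^sup>2)"
    unfolding expectation_coins_insert[OF insert.hyps p] split g_def ..
  also have "\<dots> \<le> measure_pmf.expectation (coins A p) (\<lambda>w. (c e)\<^sup>2 + (norm (g w - m))\<^sup>2)"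
    by (intro integral_mono) (auto intro: first)
  also have "\<dots> = (c e)\<^sup>2 + measure_pmf.expectation (coins A p) (\<lambda>w. (norm (g w - m))\<^sup>2)"
    by simp
  also have "\<dots> \<le> (c e)\<^sup>2 + (\<Sum>d\<in>A. (c d)\<^sup>2)"
    unfolding m by (intro add_left_mono insert.IH gdiff)
  finally show ?case using insert.hyps unfolding m_def by simp
qed

section \<open>The resolvent on the imaginary axis\<close>

definition eigenvals :: "nat \<Rightarrow> (nat \<Rightarrow> nat \<Rightarrow> real) \<Rightarrow> nat \<Rightarrow> real" where
  "eigenvals n a = (SOME l. \<exists>u. spectral n a l u)"

definition eigenvecs :: "nat \<Rightarrow> (nat \<Rightarrow> nat \<Rightarrow> real) \<Rightarrow> nat \<Rightarrow> nat \<Rightarrow> real" where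
  "eigenvecs n a = (SOME u. spectral n a (eigenvals n a) u)"

definition symmetric_array :: "nat \<Rightarrow> (nat \<Rightarrow> nat \<Rightarrow> real) \<Rightarrow> bool" where
  "symmetric_array n a \<longleftrightarrow> (\<forall>i<n. \<forall>j<n. a i j = a j i)"

lemma spectral_eigenvals:
  assumes "symmetric_array n a"
  shows "spectral n a (eigenvals n a) (eigenvecs n a)"
proof -
  have "\<exists>l u. spectral n a l u"
    using assms unfolding symmetric_array_def by (intro spectral_decomposition_exists) auto
  hence "\<exists>u. spectral n a (eigenvals n a) u" unfolding eigenvals_def by (rule someI_ex)
  thus ?thesis unfolding eigenvecs_def by (rule someI_ex)
qed

text \<open>
  The entries of \<open>(a - \<i> y)\<^sup>-\<^sup>1\<close>, through the functional calculus: \<open>Complex l (- y)\<close> is \<open>l - \<i> y\<close>.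
\<close>

definition resolvent :: "nat \<Rightarrow> (nat \<Rightarrow> nat \<Rightarrow> real) \<Rightarrow> real \<Rightarrow> nat \<Rightarrow> nat \<Rightarrow> complex" where
  "resolvent n a y i j = (\<Sum>k<n. complex_of_real (eigenvecs n a k i * eigenvecs n a k j) /
      Complex (eigenvals n a k) (- y))"

lemma resolvent_sym: "resolvent n a y i j = resolvent n a y j i"
  unfolding resolvent_def by (simp add: mult.commute)

lemma resolvent_equation:
  assumes a: "symmetric_array n a" and y: "y > 0" and ij: "i < n" "j < n"
  shows "(\<Sum>h<n. complex_of_real (a i h) * resolvent n a y h j) =
    \<i> * y * resolvent n a y i j + (if i = j then 1 else 0)"
proof -
  let ?l = "eigenvals n a" and ?u = "eigenvecs n a"
  note sp = spectral_eigenvals[OF a]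
  have compl: "(\<Sum>k<n. ?u k i * ?u k j) = (if i = j then 1 else 0)"
    using sp ij unfolding spectral_def orthonormal_family_def by auto
  have z: "Complex (?l k) (- y) \<noteq> 0" for k using y by (simp add: complex_eq_iff)
  have "(\<Sum>h<n. complex_of_real (a i h) * resolvent n a y h j)
      = (\<Sum>h<n. \<Sum>k<n. complex_of_real (a i h * ?u k h) * (complex_of_real (?u k j) / Complex (?l k) (- y)))"
    unfolding resolvent_def sum_distrib_left by (intro sum.cong refl) simp
  also have "\<dots> = (\<Sum>k<n. complex_of_real (\<Sum>h<n. a i h * ?u k h) * (complex_of_real (?u k j) / Complex (?l k) (- y)))"
    by (subst sum.swap) (simp only: of_real_sum sum_distrib_right)
  also have "\<dots> = (\<Sum>k<n. \<i> * y * (complex_of_real (?u k i * ?u k j) / Complex (?l k) (- y)) + complex_of_real (?u k i * ?u k j))"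
  proof (rule sum.cong[OF refl])
    fix k assume "k \<in> {..<n}"
    hence "(\<Sum>h<n. a i h * ?u k h) = ?l k * ?u k i" using spectral_eigenvector[OF sp] ij by simp
    moreover have "complex_of_real (?l k) = \<i> * y + Complex (?l k) (- y)" by (simp add: complex_eq_iff)
    ultimately show "complex_of_real (\<Sum>h<n. a i h * ?u k h) * (complex_of_real (?u k j) / Complex (?l k) (- y)) =
        \<i> * y * (complex_of_real (?u k i * ?u k j) / Complex (?l k) (- y)) + complex_of_real (?u k i * ?u k j)"
      using z[of k] by (simp add: field_simps del: of_real_sum)
  qed
  also have "\<dots> = \<i> * y * resolvent n a y i j + complex_of_real (\<Sum>k<n. ?u k i * ?u k j)"
    unfolding resolvent_def sum.distrib by (simp add: sum_distrib_left)
  finally show ?thesis unfolding compl by simp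
qed

lemma orthonormal_parseval:
  assumes "orthonormal_family n u"
  shows "(\<Sum>j<n. (\<Sum>k<n. b k * u k j)\<^sup>2) = (\<Sum>k<n. (b k)\<^sup>2)"
proof -
  have orth: "\<And>k l. k < n \<Longrightarrow> l < n \<Longrightarrow> (\<Sum>i<n. u k i * u l i) = (if k = l then 1 else 0)"
    using assms unfolding orthonormal_family_def by auto
  have "(\<Sum>j<n. (\<Sum>k<n. b k * u k j)\<^sup>2) = (\<Sum>j<n. \<Sum>k<n. \<Sum>l<n. b k * b l * (u k j * u l j))"
    by (simp add: power2_eq_square sum_product mult_ac)
  also have "\<dots> = (\<Sum>k<n. \<Sum>j<n. \<Sum>l<n. b k * b l * (u k j * u l j))" by (rule sum.swap)
  also have "\<dots> = (\<Sum>k<n. \<Sum>l<n. \<Sum>j<n. b k * b l * (u k j * u l j))"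
    by (rule sum.cong[OF refl]) (rule sum.swap)
  also have "\<dots> = (\<Sum>k<n. \<Sum>l<n. if k = l then (b k)\<^sup>2 else 0)"
    by (intro sum.cong refl) (auto simp: sum_distrib_left[symmetric] orth power2_eq_square)
  finally show ?thesis by simp
qed

text \<open>
  The coordinates of a row in the eigenbasis are \<open>u\<^sub>k\<^sub>i / (l\<^sub>k - \<i> y)\<close>, so Parseval's identity applies
  to real and imaginary parts. All size estimates for the resolvent reduce to this one.
\<close>

lemma resolvent_row_norm:
  assumes a: "symmetric_array n a" and y: "y > 0" and i: "i < n"
  shows "(\<Sum>j<n. (cmod (resolvent n a y i j))\<^sup>2) \<le> 1 / y\<^sup>2"
proof -
  let ?l = "eigenvals n a" and ?u = "eigenvecs n a"
  have on: "orthonormal_family n ?u" using spectral_eigenvals[OF a] unfolding spectral_def by simp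
  define c where "c k = 1 / Complex (?l k) (- y)" for k
  have G: "resolvent n a y i j = (\<Sum>k<n. c k * complex_of_real (?u k i * ?u k j))" for j
    unfolding resolvent_def c_def by simp
  have "Re (resolvent n a y i j) = (\<Sum>k<n. (Re (c k) * ?u k i) * ?u k j)"
    "Im (resolvent n a y i j) = (\<Sum>k<n. (Im (c k) * ?u k i) * ?u k j)" for j
    unfolding G by (simp_all add: mult_ac)
  hence "(\<Sum>j<n. (cmod (resolvent n a y i j))\<^sup>2) =
      (\<Sum>j<n. (\<Sum>k<n. (Re (c k) * ?u k i) * ?u k j)\<^sup>2) + (\<Sum>j<n. (\<Sum>k<n. (Im (c k) * ?u k i) * ?u k j)\<^sup>2)"
    by (simp add: cmod_power2 sum.distrib)
  also have "\<dots> = (\<Sum>k<n. (cmod (c k))\<^sup>2 * (?u k i * ?u k i))"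
    unfolding orthonormal_parseval[OF on] sum.distrib[symmetric]
    by (intro sum.cong refl) (simp only: cmod_power2 power_mult_distrib, simp add: power2_eq_square algebra_simps)
  also have "\<dots> \<le> (\<Sum>k<n. 1 / y\<^sup>2 * (?u k i * ?u k i))"
  proof (intro sum_mono mult_right_mono)
    fix k
    have "(cmod (c k))\<^sup>2 = 1 / ((?l k)\<^sup>2 + y\<^sup>2)"
      unfolding c_def by (simp add: norm_divide power_divide cmod_power2)
    also have "\<dots> \<le> 1 / y\<^sup>2" using y by (intro divide_left_mono) (auto simp: add_nonneg_pos)
    finally show "(cmod (c k))\<^sup>2 \<le> 1 / y\<^sup>2" .
  qed simp
  also have "\<dots> = 1 / y\<^sup>2"
    using on i unfolding orthonormal_family_def sum_distrib_left[symmetric] by simp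
  finally show ?thesis .
qed

lemma resolvent_entry_bound:
  assumes a: "symmetric_array n a" and y: "y > 0" and ij: "i < n" "j < n"
  shows "cmod (resolvent n a y i j) \<le> 1 / y"
proof -
  have "(cmod (resolvent n a y i j))\<^sup>2 \<le> (\<Sum>j<n. (cmod (resolvent n a y i j))\<^sup>2)"
    by (rule member_le_sum) (use ij in auto)
  also have "\<dots> \<le> (1 / y)\<^sup>2" using resolvent_row_norm[OF a y ij(1)] by (simp add: power_divide)
  finally show ?thesis using y by (simp add: power2_le_iff_abs_le)
qed

lemma resolvent_product_bound:
  assumes a: "symmetric_array n a" and b: "symmetric_array n b" and y: "y > 0" and ij: "i < n" "j < n"
  shows "cmod (\<Sum>h<n. resolvent n a y i h * resolvent n b y j h) \<le> 1 / y\<^sup>2"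
proof -
  let ?G = "resolvent n a y i" and ?H = "resolvent n b y j"
  have "cmod (\<Sum>h<n. ?G h * ?H h) \<le> (\<Sum>h<n. cmod (?G h) * cmod (?H h))"
    by (rule order_trans[OF norm_sum]) (simp add: norm_mult)
  also have "\<dots> \<le> (\<Sum>h<n. ((cmod (?G h))\<^sup>2 + (cmod (?H h))\<^sup>2) / 2)"
  proof (rule sum_mono)
    fix h show "cmod (?G h) * cmod (?H h) \<le> ((cmod (?G h))\<^sup>2 + (cmod (?H h))\<^sup>2) / 2"
      using sum_squares_bound[of "cmod (?G h)" "cmod (?H h)"] by simp
  qed
  also have "\<dots> = ((\<Sum>h<n. (cmod (?G h))\<^sup>2) + (\<Sum>h<n. (cmod (?H h))\<^sup>2)) / 2"
    by (simp add: sum.distrib sum_divide_distrib[symmetric])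
  also have "\<dots> \<le> 1 / y\<^sup>2"
    using resolvent_row_norm[OF a y ij(1)] resolvent_row_norm[OF b y ij(2)] by simp
  finally show ?thesis .
qed

text \<open>
  Both sides of \<open>H - G = H (a - b) G\<close> are compared with \<open>H a G\<close> and \<open>H b G\<close>, which the equations
  \<open>a G = 1 + \<i> y G\<close> and \<open>H b = 1 + \<i> y H\<close> evaluate.
\<close>

lemma resolvent_identity:
  assumes a: "symmetric_array n a" and b: "symmetric_array n b" and y: "y > 0" and ik: "i < n" "k < n"
  shows "resolvent n b y i k - resolvent n a y i k =
    (\<Sum>j<n. \<Sum>h<n. resolvent n b y i j * complex_of_real (a j h - b j h) * resolvent n a y h k)"
proof -
  let ?G = "resolvent n a y" and ?H = "resolvent n b y"
  have 1: "(\<Sum>j<n. \<Sum>h<n. ?H i j * (complex_of_real (a j h) * ?G h k)) = \<i> * y * (\<Sum>j<n. ?H i j * ?G j k) + ?H i k"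
  proof -
    have "(\<Sum>j<n. \<Sum>h<n. ?H i j * (complex_of_real (a j h) * ?G h k))
        = (\<Sum>j<n. ?H i j * (\<i> * y * ?G j k + (if j = k then 1 else 0)))"
      unfolding sum_distrib_left[symmetric]
      by (intro sum.cong refl) (simp add: resolvent_equation[OF a y _ ik(2)])
    also have "\<dots> = (\<Sum>j<n. \<i> * y * (?H i j * ?G j k) + (if j = k then ?H i k else 0))"
      by (intro sum.cong refl) (simp add: algebra_simps)
    finally show ?thesis using ik by (simp add: sum.distrib sum_distrib_left)
  qed
  have 2: "(\<Sum>j<n. \<Sum>h<n. ?H i j * (complex_of_real (b j h) * ?G h k)) = \<i> * y * (\<Sum>j<n. ?H i j * ?G j k) + ?G i k"
  proof -
    have "(\<Sum>j<n. \<Sum>h<n. ?H i j * (complex_of_real (b j h) * ?G h k))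
        = (\<Sum>h<n. (\<Sum>j<n. complex_of_real (b h j) * ?H j i) * ?G h k)"
      unfolding sum_distrib_right using b unfolding symmetric_array_def
      by (subst sum.swap) (intro sum.cong refl, simp add: resolvent_sym[of n b y _ i])
    also have "\<dots> = (\<Sum>h<n. \<i> * y * (?H i h * ?G h k) + (if h = i then ?G i k else 0))"
      using ik by (intro sum.cong refl) (simp add: resolvent_equation[OF b y _ ik(1)] resolvent_sym[of n b y i] algebra_simps)
    finally show ?thesis using ik by (simp add: sum.distrib sum_distrib_left)
  qed
  have "(\<Sum>j<n. \<Sum>h<n. ?H i j * complex_of_real (a j h - b j h) * ?G h k) =
    (\<Sum>j<n. \<Sum>h<n. ?H i j * (complex_of_real (a j h) * ?G h k)) - (\<Sum>j<n. \<Sum>h<n. ?H i j * (complex_of_real (b j h) * ?G h k))"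
    unfolding sum_subtractf[symmetric] by (intro sum.cong refl) (simp add: algebra_simps)
  thus ?thesis unfolding 1 2 by simp
qed

lemma sum_single_pair:
  fixes x :: complex and n :: nat
  assumes "r < n" "s < n"
  shows "(\<Sum>j<n. \<Sum>h<n. if j = r \<and> h = s then x else 0) = x"
proof -
  have "(\<Sum>j<n. \<Sum>h<n. if j = r \<and> h = s then x else 0) = (\<Sum>j<n. if j = r then x else 0)"
    using assms by (intro sum.cong refl) auto
  thus ?thesis using assms by simp
qed

lemma resolvent_entry_change:
  assumes a: "symmetric_array n a" and b: "symmetric_array n b" and y: "y > 0" and ik: "i < n" "k < n"
    and rs: "r < n" "s < n" "r \<noteq> s"
    and diff: "\<And>j h. j < n \<Longrightarrow> h < n \<Longrightarrow> b j h = a j h + (if {j, h} = {r, s} then t else 0)"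
  shows "resolvent n b y i k - resolvent n a y i k =
    - complex_of_real t * (resolvent n b y i r * resolvent n a y s k + resolvent n b y i s * resolvent n a y r k)"
proof -
  let ?G = "resolvent n a y" and ?H = "resolvent n b y"
  have "?H i k - ?G i k = (\<Sum>j<n. \<Sum>h<n. ?H i j * complex_of_real (a j h - b j h) * ?G h k)"
    by (rule resolvent_identity[OF a b y ik])
  also have "\<dots> = (\<Sum>j<n. \<Sum>h<n. (if j = r \<and> h = s then - complex_of_real t * (?H i r * ?G s k) else 0) +
       (if j = s \<and> h = r then - complex_of_real t * (?H i s * ?G r k) else 0))"
    using rs by (intro sum.cong refl) (auto simp: diff doubleton_eq_iff)
  also have "\<dots> = - complex_of_real t * (?H i r * ?G s k) + - complex_of_real t * (?H i s * ?G r k)"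
    unfolding sum.distrib using rs by (simp only: sum_single_pair)
  also have "\<dots> = - complex_of_real t * (?H i r * ?G s k + ?H i s * ?G r k)"
    by (simp add: algebra_simps)
  finally show ?thesis .
qed

lemma resolvent_entry_perturbation:
  assumes a: "symmetric_array n a" and b: "symmetric_array n b" and y: "y > 0" and ik: "i < n" "k < n"
    and rs: "r < n" "s < n" "r \<noteq> s"
    and diff: "\<And>j h. j < n \<Longrightarrow> h < n \<Longrightarrow> b j h = a j h + (if {j, h} = {r, s} then t else 0)"
  shows "cmod (resolvent n b y i k - resolvent n a y i k) \<le> 2 * \<bar>t\<bar> / y\<^sup>2"
proof -
  let ?G = "resolvent n a y" and ?H = "resolvent n b y"
  have e: "cmod (?H i r' * ?G s' k) \<le> 1 / y\<^sup>2" if "r' < n" "s' < n" for r' s'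
  proof -
    have "cmod (?H i r') * cmod (?G s' k) \<le> (1 / y) * (1 / y)"
      using that ik y by (intro mult_mono resolvent_entry_bound a b) auto
    thus ?thesis by (simp add: norm_mult power2_eq_square)
  qed
  have "cmod (?H i k - ?G i k) = \<bar>t\<bar> * cmod (?H i r * ?G s k + ?H i s * ?G r k)"
    by (simp only: resolvent_entry_change[OF a b y ik rs diff] norm_mult norm_minus_cancel norm_of_real)
  also have "\<dots> \<le> \<bar>t\<bar> * (1 / y\<^sup>2 + 1 / y\<^sup>2)"
    using rs by (intro mult_left_mono order_trans[OF norm_triangle_ineq] add_mono e) auto
  finally show ?thesis by (simp add: mult.commute)
qed

text \<open>
  Cyclicity turns the trace into two entries of the product of the resolvents, each bounded by the row
  norms. Summing the bounds for the diagonal entries instead would lose a factor \<open>n\<close>, which the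
  variance estimate could not afford.
\<close>

lemma resolvent_trace_perturbation:
  assumes a: "symmetric_array n a" and b: "symmetric_array n b" and y: "y > 0"
    and rs: "r < n" "s < n" "r \<noteq> s"
    and diff: "\<And>j h. j < n \<Longrightarrow> h < n \<Longrightarrow> b j h = a j h + (if {j, h} = {r, s} then t else 0)"
  shows "cmod ((\<Sum>i<n. resolvent n b y i i) - (\<Sum>i<n. resolvent n a y i i)) \<le> 2 * \<bar>t\<bar> / y\<^sup>2"
proof -
  let ?G = "resolvent n a y" and ?H = "resolvent n b y"
  have "(\<Sum>i<n. ?H i i) - (\<Sum>i<n. ?G i i) = (\<Sum>i<n. - complex_of_real t * (?H i r * ?G s i + ?H i s * ?G r i))"
    unfolding sum_subtractf[symmetric]
    by (intro sum.cong refl) (simp add: resolvent_entry_change[OF a b y _ _ rs diff])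
  also have "\<dots> = - complex_of_real t * ((\<Sum>i<n. ?H r i * ?G s i) + (\<Sum>i<n. ?H s i * ?G r i))"
    unfolding sum_distrib_left[symmetric] sum.distrib
    by (simp add: resolvent_sym[of n b y _ r] resolvent_sym[of n b y _ s])
  also have "cmod \<dots> \<le> \<bar>t\<bar> * (1 / y\<^sup>2 + 1 / y\<^sup>2)"
    unfolding norm_mult norm_minus_cancel norm_of_real
    using rs by (intro mult_left_mono order_trans[OF norm_triangle_ineq] add_mono resolvent_product_bound a b y) auto
  finally show ?thesis by (simp add: mult.commute)
qed

lemma resolvent_trace:
  assumes a: "symmetric_array n a"
  shows "(\<Sum>i<n. resolvent n a y i i) = (\<Sum>k<n. 1 / Complex (eigenvals n a k) (- y))"
proof -
  let ?l = "eigenvals n a" and ?u = "eigenvecs n a"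
  have orth: "\<And>k. k < n \<Longrightarrow> (\<Sum>i<n. ?u k i * ?u k i) = 1"
    using spectral_eigenvals[OF a] unfolding spectral_def orthonormal_family_def by auto
  have "(\<Sum>i<n. resolvent n a y i i) = (\<Sum>k<n. \<Sum>i<n. complex_of_real (?u k i * ?u k i) / Complex (?l k) (- y))"
    unfolding resolvent_def by (rule sum.swap)
  also have "\<dots> = (\<Sum>k<n. complex_of_real (\<Sum>i<n. ?u k i * ?u k i) / Complex (?l k) (- y))"
    by (simp add: sum_divide_distrib)
  finally show ?thesis by (simp add: orth del: of_real_sum)
qed

lemma Im_resolvent_trace:
  assumes a: "symmetric_array n a"
  shows "Im (\<Sum>i<n. resolvent n a y i i) = (\<Sum>k<n. y / ((eigenvals n a k)\<^sup>2 + y\<^sup>2))"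
  unfolding resolvent_trace[OF a] Im_sum by (intro sum.cong refl) (simp add: Im_divide)

section \<open>Coulson's integral and the semicircle equation\<close>

lemma has_bochner_integral_FTC_atLeast:
  fixes f F :: "real \<Rightarrow> real"
  assumes f: "f \<in> borel_measurable borel"
    and F: "\<And>x. a \<le> x \<Longrightarrow> (F has_real_derivative f x) (at x)"
    and nonneg: "\<And>x. a \<le> x \<Longrightarrow> 0 \<le> f x"
    and lim: "(F \<longlongrightarrow> T) at_top"
  shows "has_bochner_integral lborel (\<lambda>x. f x * indicator {a..} x) (T - F a)"
proof (rule has_bochner_integral_nn_integral)
  have mono: "F a \<le> F x" if "a \<le> x" for x
    using that by (intro DERIV_nonneg_imp_nondecreasing[of a x F]) (use F nonneg in blast)+
  have "F a \<le> T"
    by (rule tendsto_lowerbound[OF lim]) (auto intro!: mono eventually_at_top_linorderI[of a])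
  thus "0 \<le> T - F a" by simp
  have "(\<integral>\<^sup>+x. ennreal (f x * indicator {a..} x) \<partial>lborel) = (\<integral>\<^sup>+x. ennreal (f x) * indicator {a..} x \<partial>lborel)"
    by (intro nn_integral_cong) (auto split: split_indicator)
  thus "(\<integral>\<^sup>+x. ennreal (f x * indicator {a..} x) \<partial>lborel) = ennreal (T - F a)"
    using nn_integral_FTC_atLeast[OF f F nonneg lim] by simp
qed (use f nonneg in \<open>auto split: split_indicator\<close>)

lemma abs_eq_integral:
  fixes l :: real
  shows "has_bochner_integral lborel (\<lambda>y. l\<^sup>2 / (l\<^sup>2 + y\<^sup>2) * indicator {0..} y) (pi / 2 * \<bar>l\<bar>)"
proof (cases "l = 0")
  case True thus ?thesis by (simp add: has_bochner_integral_zero)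
next
  case False
  define F where "F y = \<bar>l\<bar> * arctan (y / \<bar>l\<bar>)" for y
  have F: "(F has_real_derivative l\<^sup>2 / (l\<^sup>2 + y\<^sup>2)) (at y)" for y
    unfolding F_def using False
    by (auto intro!: derivative_eq_intros simp: field_simps power2_eq_square)
  have lim: "(F \<longlongrightarrow> \<bar>l\<bar> * (pi / 2)) at_top"
  proof -
    have "((\<lambda>y. c * arctan (y / c)) \<longlongrightarrow> c * (pi / 2)) at_top" if "c > 0" for c :: real
      using that by real_asymp
    thus ?thesis unfolding F_def using False by simp
  qed
  have "has_bochner_integral lborel (\<lambda>y. l\<^sup>2 / (l\<^sup>2 + y\<^sup>2) * indicator {0..} y) (\<bar>l\<bar> * (pi / 2) - F 0)"
    by (rule has_bochner_integral_FTC_atLeast[OF _ F _ lim]) auto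
  thus ?thesis by (simp add: F_def mult.commute)
qed

text \<open>
  The Stieltjes transform of the semicircle law of variance \<open>s\<^sup>2\<close>, at the point \<open>\<i> y\<close>, is
  \<open>\<i> g\<close> for this value \<open>g\<close>.
\<close>

definition semicircle_g :: "real \<Rightarrow> real \<Rightarrow> real" where
  "semicircle_g s y = (sqrt (y\<^sup>2 + 4 * s\<^sup>2) - y) / (2 * s\<^sup>2)"

lemma semicircle_integral:
  assumes s: "s > 0"
  shows "has_bochner_integral lborel (\<lambda>y. (1 - y * semicircle_g s y) * indicator {0..} y) (4 * s / 3)"
proof -
  \<comment> \<open>The antiderivative is normalised to vanish at infinity, and \<open>F 0 = - 4 s / 3\<close>.\<close>
  define F where "F y = y + y ^ 3 / (6 * s\<^sup>2) - (y\<^sup>2 + 4 * s\<^sup>2) * sqrt (y\<^sup>2 + 4 * s\<^sup>2) / (6 * s\<^sup>2)" for y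
  have pos: "y\<^sup>2 + 4 * s\<^sup>2 > 0" for y using s by (simp add: add_nonneg_pos)
  have F: "(F has_real_derivative (1 - y * semicircle_g s y)) (at y)" for y
  proof -
    have sq: "sqrt (y\<^sup>2 + 4 * s\<^sup>2) * sqrt (y\<^sup>2 + 4 * s\<^sup>2) = y\<^sup>2 + 4 * s\<^sup>2" using pos[of y] by simp
    have d: "(F has_real_derivative (1 + 3 * y\<^sup>2 / (6 * s\<^sup>2) - (2 * y * sqrt (y\<^sup>2 + 4 * s\<^sup>2)
        + (y\<^sup>2 + 4 * s\<^sup>2) * (2 * y * inverse (sqrt (y\<^sup>2 + 4 * s\<^sup>2)) / 2)) / (6 * s\<^sup>2))) (at y)"
    proof -
      have "((\<lambda>y. y + y ^ 3 / (6 * K) - (y\<^sup>2 + 4 * K) * sqrt (y\<^sup>2 + 4 * K) / (6 * K)) has_real_derivative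
          (1 + 3 * y\<^sup>2 / (6 * K) - (2 * y * sqrt (y\<^sup>2 + 4 * K)
            + (y\<^sup>2 + 4 * K) * (2 * y * inverse (sqrt (y\<^sup>2 + 4 * K)) / 2)) / (6 * K))) (at y)"
        if "K > 0" for K :: real
      proof -
        have "y\<^sup>2 + 4 * K > 0" using that by (simp add: add_nonneg_pos)
        hence "((\<lambda>y. sqrt (y\<^sup>2 + 4 * K)) has_real_derivative (2 * y * inverse (sqrt (y\<^sup>2 + 4 * K)) / 2)) (at y)"
          by (auto intro!: derivative_eq_intros simp: field_simps)
        moreover have "((\<lambda>y. y\<^sup>2 + 4 * K) has_real_derivative 2 * y) (at y)"
          by (auto intro!: derivative_eq_intros)
        ultimately
        have "((\<lambda>y. (y\<^sup>2 + 4 * K) * sqrt (y\<^sup>2 + 4 * K)) has_real_derivative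
           (2 * y * sqrt (y\<^sup>2 + 4 * K) + (y\<^sup>2 + 4 * K) * (2 * y * inverse (sqrt (y\<^sup>2 + 4 * K)) / 2))) (at y)"
          by (intro DERIV_cong[OF DERIV_mult]) (assumption | simp add: mult.commute)+
        moreover have "((\<lambda>y. y + y ^ 3 / (6 * K)) has_real_derivative 1 + 3 * y\<^sup>2 / (6 * K)) (at y)"
          using that by (auto intro!: derivative_eq_intros)
        ultimately show ?thesis by (intro DERIV_diff DERIV_cdivide)
      qed
      from this[of "s\<^sup>2"] show ?thesis unfolding F_def using s by simp
    qed
    have e: "(y\<^sup>2 + 4 * s\<^sup>2) * (2 * y * inverse (sqrt (y\<^sup>2 + 4 * s\<^sup>2)) / 2) = y * sqrt (y\<^sup>2 + 4 * s\<^sup>2)"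
      using pos[of y] by (subst sq[symmetric]) (simp add: field_simps)
    have alg: "1 + 3 * y\<^sup>2 / (6 * K) - (2 * y * R + y * R) / (6 * K) = 1 - y * ((R - y) / (2 * K))"
      if "K > 0" for K R :: real
      using that by (simp add: field_simps power2_eq_square)
    show ?thesis
      using d unfolding e semicircle_g_def alg[of "s\<^sup>2", OF zero_less_power[OF s]] .
  qed
  have lim: "(F \<longlongrightarrow> 0) at_top"
    unfolding F_def using s by real_asymp
  have nn: "1 - y * semicircle_g s y \<ge> 0" if "y \<ge> 0" for y
  proof -
    have "sqrt (y\<^sup>2 + 4 * s\<^sup>2) * y \<le> ((sqrt (y\<^sup>2 + 4 * s\<^sup>2))\<^sup>2 + y\<^sup>2) / 2"
      using sum_squares_bound[of "sqrt (y\<^sup>2 + 4 * s\<^sup>2)" y] by simp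
    thus ?thesis using s pos[of y] unfolding semicircle_g_def by (simp add: field_simps power2_eq_square)
  qed
  have "has_bochner_integral lborel (\<lambda>y. (1 - y * semicircle_g s y) * indicator {0..} y) (0 - F 0)"
    by (rule has_bochner_integral_FTC_atLeast[OF _ F nn lim]) (auto simp: semicircle_g_def)
  moreover have "0 - F 0 = 4 * s / 3"
    using s by (simp add: F_def real_sqrt_mult power2_eq_square)
  ultimately show ?thesis by (simp only:)
qed

lemma semicircle_g_pos: "s > 0 \<Longrightarrow> y > 0 \<Longrightarrow> semicircle_g s y > 0"
  unfolding semicircle_g_def by (intro divide_pos_pos) (auto intro!: real_less_rsqrt)


text \<open>
  Dominated convergence for the mean error at each \<open>y\<close>; the finite support makes the interchange of
  mean and integral a finite sum.
\<close>

lemma integral_convergence_in_mean: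
  fixes P :: "nat \<Rightarrow> 'w pmf" and h :: "nat \<Rightarrow> 'w \<Rightarrow> 'y \<Rightarrow> real"
  assumes fin: "\<And>n. finite (set_pmf (P n))"
    and meas: "\<And>n w. h n w \<in> borel_measurable M"
    and bound: "\<And>n w y. \<bar>h n w y\<bar> \<le> B y"
    and B: "integrable M B" and H: "integrable M H"
    and conv: "AE y in M. (\<lambda>n. measure_pmf.expectation (P n) (\<lambda>w. \<bar>h n w y - H y\<bar>)) \<longlonglongrightarrow> 0"
  shows "(\<lambda>n. measure_pmf.expectation (P n) (\<lambda>w. \<bar>(\<integral>y. h n w y \<partial>M) - (\<integral>y. H y \<partial>M)\<bar>)) \<longlonglongrightarrow> 0"
proof -
  have E: "measure_pmf.expectation (P n) f = (\<Sum>w\<in>set_pmf (P n). pmf (P n) w * f w)" for n and f :: "'w \<Rightarrow> real"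
    using integral_measure_pmf[OF fin[of n], of "P n" f] by simp
  define D where "D n y = measure_pmf.expectation (P n) (\<lambda>w. \<bar>h n w y - H y\<bar>)" for n y
  have hint: "integrable M (h n w)" for n w
    by (rule Bochner_Integration.integrable_bound[OF B meas]) (use bound in \<open>auto intro!: AE_I2 order_trans[OF bound]\<close>)
  have dint: "integrable M (\<lambda>y. \<bar>h n w y - H y\<bar>)" for n w
    by (intro integrable_abs Bochner_Integration.integrable_diff hint H)
  have D_bound: "\<bar>D n y\<bar> \<le> B y + \<bar>H y\<bar>" for n y
  proof -
    have "D n y \<le> measure_pmf.expectation (P n) (\<lambda>w. B y + \<bar>H y\<bar>)"
      unfolding D_def
    proof (rule integral_mono)
      fix w show "\<bar>h n w y - H y\<bar> \<le> B y + \<bar>H y\<bar>" using bound[of n w y] by linarith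
    qed (auto intro: integrable_measure_pmf_finite fin)
    moreover have "D n y \<ge> 0" unfolding D_def by (rule Bochner_Integration.integral_nonneg) simp
    ultimately show ?thesis by simp
  qed
  have D_int: "(\<integral>y. D n y \<partial>M) = measure_pmf.expectation (P n) (\<lambda>w. \<integral>y. \<bar>h n w y - H y\<bar> \<partial>M)" for n
    unfolding D_def E by (subst Bochner_Integration.integral_sum) (auto intro!: integrable_mult_right dint)
  have "(\<lambda>n. \<integral>y. D n y \<partial>M) \<longlonglongrightarrow> (\<integral>y. 0 \<partial>M)"
  proof (rule integral_dominated_convergence[where w = "\<lambda>y. B y + \<bar>H y\<bar>"])
    show "D n \<in> borel_measurable M" for n
      unfolding D_def E using dint by (intro borel_measurable_sum borel_measurable_times) auto
    show "AE y in M. (\<lambda>n. D n y) \<longlonglongrightarrow> 0" using conv unfolding D_def .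
  qed (use B H D_bound in auto)
  hence lim: "(\<lambda>n. \<integral>y. D n y \<partial>M) \<longlonglongrightarrow> 0" by simp
  have upper: "measure_pmf.expectation (P n) (\<lambda>w. \<bar>(\<integral>y. h n w y \<partial>M) - (\<integral>y. H y \<partial>M)\<bar>) \<le> (\<integral>y. D n y \<partial>M)" for n
    unfolding D_int
  proof (rule integral_mono)
    fix w
    have "(\<integral>y. h n w y \<partial>M) - (\<integral>y. H y \<partial>M) = (\<integral>y. h n w y - H y \<partial>M)"
      by (rule Bochner_Integration.integral_diff[symmetric, OF hint H])
    thus "\<bar>(\<integral>y. h n w y \<partial>M) - (\<integral>y. H y \<partial>M)\<bar> \<le> (\<integral>y. \<bar>h n w y - H y\<bar> \<partial>M)"
      by (simp add: integral_abs_bound)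
  qed (auto intro: integrable_measure_pmf_finite fin)
  show ?thesis
    by (rule tendsto_sandwich[OF _ _ tendsto_const lim]) (auto intro!: always_eventually upper Bochner_Integration.integral_nonneg)
qed

lemma semicircle_g_root:
  assumes "s > 0"
  shows "s\<^sup>2 * (semicircle_g s y)\<^sup>2 + y * semicircle_g s y = 1"
proof -
  have "(sqrt (y\<^sup>2 + 4 * s\<^sup>2))\<^sup>2 = y\<^sup>2 + 4 * s\<^sup>2" by (simp add: add_nonneg_nonneg)
  moreover have "K * ((R - y) / (2 * K))\<^sup>2 + y * ((R - y) / (2 * K)) = 1"
    if "K > 0" "R\<^sup>2 = y\<^sup>2 + 4 * K" for K R
  proof -
    have "K * ((R - y) / (2 * K))\<^sup>2 + y * ((R - y) / (2 * K)) = (R\<^sup>2 - y\<^sup>2) / (4 * K)"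
      using that(1) by (simp add: field_simps power2_eq_square)
    thus ?thesis using that by simp
  qed
  ultimately show ?thesis unfolding semicircle_g_def using assms by simp
qed

text \<open>
  The polynomial is \<open>s\<^sup>2 (m - \<i> g) (m + \<i> g')\<close> with \<open>g, g' > 0\<close>. In the closed upper half-plane the
  second factor has modulus at least \<open>g'\<close>, and \<open>s\<^sup>2 g' \<ge> y\<close>.
\<close>
lemma semicircle_equation_stability:
  assumes s: "s > 0" and y: "y > 0" and m: "Im m \<ge> 0"
  shows "cmod (m - \<i> * semicircle_g s y) \<le> cmod (1 + \<i> * y * m + s\<^sup>2 * m\<^sup>2) / y"
proof -
  define g where "g = semicircle_g s y"
  define g' where "g' = g + y / s\<^sup>2"
  have g: "g > 0" unfolding g_def by (rule semicircle_g_pos[OF s y])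
  have sg': "s\<^sup>2 * g' = s\<^sup>2 * g + y" unfolding g'_def using s by (simp add: field_simps)
  have gg': "s\<^sup>2 * (g * g') = 1"
    using semicircle_g_root[OF s, of y] unfolding g_def[symmetric]
    by (metis sg' distrib_left mult.assoc mult.commute power2_eq_square)
  have g'0: "g' > 0" unfolding g'_def using g s y by (simp add: add_pos_pos)
  have "1 + \<i> * y * m + s\<^sup>2 * m\<^sup>2 = s\<^sup>2 * ((m - \<i> * g) * (m + \<i> * g'))"
  proof -
    have 1: "complex_of_real (s\<^sup>2) * (complex_of_real g * complex_of_real g') = 1"
      unfolding of_real_mult[symmetric] gg' by simp
    have 2: "complex_of_real y = complex_of_real (s\<^sup>2) * complex_of_real g' - complex_of_real (s\<^sup>2) * complex_of_real g"
      unfolding of_real_mult[symmetric] sg' by simp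
    have "complex_of_real (s\<^sup>2) * ((m - \<i> * g) * (m + \<i> * g')) =
       complex_of_real (s\<^sup>2) * (complex_of_real g * complex_of_real g') +
       \<i> * (complex_of_real (s\<^sup>2) * complex_of_real g' - complex_of_real (s\<^sup>2) * complex_of_real g) * m + complex_of_real (s\<^sup>2) * m\<^sup>2"
      by (simp add: algebra_simps power2_eq_square)
    thus ?thesis unfolding 1 2[symmetric] by simp
  qed
  hence eq: "cmod (1 + \<i> * y * m + s\<^sup>2 * m\<^sup>2) = s\<^sup>2 * (cmod (m - \<i> * g) * cmod (m + \<i> * g'))"
    by (simp add: norm_mult norm_power)
  have "g' \<le> Im (m + \<i> * g')" using m by simp
  also have "\<dots> \<le> cmod (m + \<i> * g')" using abs_Im_le_cmod[of "m + \<i> * g'"] by linarith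
  finally have "s\<^sup>2 * (cmod (m - \<i> * g) * g') \<le> cmod (1 + \<i> * y * m + s\<^sup>2 * m\<^sup>2)"
    unfolding eq by (intro mult_left_mono) auto
  moreover have "y * cmod (m - \<i> * g) \<le> (s\<^sup>2 * g') * cmod (m - \<i> * g)"
    unfolding sg' using g by (intro mult_right_mono) auto
  ultimately have "y * cmod (m - \<i> * g) \<le> cmod (1 + \<i> * y * m + s\<^sup>2 * m\<^sup>2)"
    by (simp add: mult_ac)
  thus ?thesis unfolding g_def using y by (simp add: field_simps)
qed

section \<open>The semicircle law for centred coins\<close>

abbreviation edges :: "nat \<Rightarrow> nat set set" where
  "edges n \<equiv> {e. e \<subseteq> {..<n} \<and> card e = 2}"

lemma finite_edges: "finite (edges n)"
  by (rule finite_subset[of _ "Pow {..<n}"]) auto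

lemma card_edges_le: "card (edges n) \<le> n\<^sup>2"
proof -
  have "card (edges n) = n choose 2" using n_subsets[of "{..<n}" 2] by simp
  also have "\<dots> \<le> n\<^sup>2" by (cases "2 \<le> n") (auto intro: binomial_le_pow simp: binomial_eq_0)
  finally show ?thesis .
qed

lemma edges_doubleton: "i < n \<Longrightarrow> j < n \<Longrightarrow> i \<noteq> j \<Longrightarrow> {i, j} \<in> edges n"
  by simp

lemma edgesE:
  assumes "e \<in> edges n"
  obtains r s where "e = {r, s}" "r < n" "s < n" "r \<noteq> s"
proof -
  have "card e = 2" "e \<subseteq> {..<n}" using assms by auto
  then obtain r s where "e = {r, s}" "r \<noteq> s" by (auto simp: card_2_iff)
  thus ?thesis using that \<open>e \<subseteq> {..<n}\<close> by auto
qed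

definition wigner :: "nat \<Rightarrow> real \<Rightarrow> (nat set \<Rightarrow> bool) \<Rightarrow> nat \<Rightarrow> nat \<Rightarrow> real" where
  "wigner n p w i j = (if i = j then 0 else (of_bool (w {i, j}) - p) / sqrt (real n))"

lemma symmetric_wigner: "symmetric_array n (wigner n p w)"
  unfolding symmetric_array_def wigner_def by (auto simp: insert_commute)

lemma wigner_flip:
  assumes "r \<noteq> s"
  shows "wigner n p (w({r, s} := b)) j h =
    wigner n p w j h + (if {j, h} = {r, s} then (of_bool b - of_bool (w {r, s})) / sqrt (real n) else 0)"
proof -
  have "{j, h} = {r, s} \<Longrightarrow> j \<noteq> h" using assms by (auto simp: doubleton_eq_iff)
  thus ?thesis unfolding wigner_def by (auto simp: diff_divide_distrib)
qed

text \<open>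
  The Stieltjes transform, at \<open>\<i> y\<close>, of the empirical distribution of the eigenvalues.
\<close>

definition stieltjes :: "nat \<Rightarrow> real \<Rightarrow> real \<Rightarrow> (nat set \<Rightarrow> bool) \<Rightarrow> complex" where
  "stieltjes n p y w = (\<Sum>i<n. resolvent n (wigner n p w) y i i) / of_nat n"

lemma two_mult_le_weighted: "r > 0 \<Longrightarrow> 2 * t \<le> 1 / r + r * t\<^sup>2" for r t :: real
proof -
  assume r: "r > 0"
  have "0 \<le> (r * t - 1)\<^sup>2 / r" using r by simp
  also have "\<dots> = 1 / r + r * t\<^sup>2 - 2 * t" using r by (simp add: field_simps power2_eq_square)
  finally show ?thesis by simp
qed

context
  fixes n :: nat and p y :: real
  assumes n: "n > 0" and p: "0 \<le> p" "p \<le> 1" and y: "y > 0"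
begin

abbreviation EE :: "((nat set \<Rightarrow> bool) \<Rightarrow> 'b :: {banach, second_countable_topology}) \<Rightarrow> 'b" where
  "EE f \<equiv> measure_pmf.expectation (coins (edges n) p) f"

abbreviation GG :: "(nat set \<Rightarrow> bool) \<Rightarrow> nat \<Rightarrow> nat \<Rightarrow> complex" where
  "GG w \<equiv> resolvent n (wigner n p w) y"

lemma integrable_edges:
  fixes f :: "_ \<Rightarrow> 'b :: {banach, second_countable_topology}"
  shows "integrable (measure_pmf (coins (edges n) p)) f"
  by (rule integrable_coins[OF finite_edges])

lemma norm_EE_le:
  fixes f :: "_ \<Rightarrow> complex"
  assumes "\<And>w. cmod (f w) \<le> B"
  shows "cmod (EE f) \<le> B"
proof -
  have "cmod (EE f) \<le> EE (\<lambda>w. cmod (f w))" by (rule integral_norm_bound)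
  also have "\<dots> \<le> EE (\<lambda>w. B)" by (rule integral_mono[OF integrable_edges integrable_edges]) (rule assms)
  finally show ?thesis by simp
qed

text \<open>
  There are at most \<open>n\<^sup>2\<close> coins, and each has influence \<open>O(n\<^sup>-\<^sup>3\<^sup>/\<^sup>2)\<close>.
\<close>

lemma stieltjes_variance:
  "EE (\<lambda>w. (cmod (stieltjes n p y w - EE (stieltjes n p y)))\<^sup>2) \<le> 4 / (n * y ^ 4)"
proof -
  define c where "c = 2 * (1 / sqrt n) / y\<^sup>2 / n"
  have "cmod (stieltjes n p y (w(e := True)) - stieltjes n p y (w(e := False))) \<le> c" if e: "e \<in> edges n" for w e
  proof -
    obtain r s where rs: "e = {r, s}" "r < n" "s < n" "r \<noteq> s" using edgesE[OF e] by blast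
    have "wigner n p (w(e := True)) j h = wigner n p (w(e := False)) j h + (if {j, h} = {r, s} then 1 / sqrt n else 0)" for j h
      using wigner_flip[OF rs(4), of n p "w(e := False)" True j h] by (simp add: rs(1))
    from resolvent_trace_perturbation[OF symmetric_wigner symmetric_wigner y rs(2-4) this]
    have "cmod ((\<Sum>i<n. GG (w(e := True)) i i) - (\<Sum>i<n. GG (w(e := False)) i i)) \<le> 2 * (1 / sqrt n) / y\<^sup>2"
      by simp
    thus ?thesis
      unfolding stieltjes_def c_def diff_divide_distrib[symmetric] norm_divide norm_of_nat
      by (intro divide_right_mono) auto
  qed
  hence "EE (\<lambda>w. (cmod (stieltjes n p y w - EE (stieltjes n p y)))\<^sup>2) \<le> (\<Sum>e\<in>edges n. c\<^sup>2)"
    by (intro efron_stein_coins finite_edges p)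
  also have "\<dots> \<le> (real n)\<^sup>2 * c\<^sup>2"
    using card_edges_le[of n] by (simp add: mult_right_mono flip: of_nat_power)
  also have "\<dots> = 4 / (n * y ^ 4)"
  proof -
    have "c\<^sup>2 = 4 * (1 / n) / y ^ 4 / (real n)\<^sup>2"
      by (simp add: c_def power_divide power_mult_distrib)
    thus ?thesis using n by simp
  qed
  finally show ?thesis .
qed

lemma GG_entry: "i < n \<Longrightarrow> j < n \<Longrightarrow> cmod (GG w i j) \<le> 1 / y"
  by (rule resolvent_entry_bound[OF symmetric_wigner y])

lemma GG_flip_bound:
  assumes rs: "r < n" "s < n" "r \<noteq> s" and ik: "i < n" "k < n"
  shows "cmod (GG (w({r, s} := b)) i k - GG w i k) \<le> 2 / (sqrt n * y\<^sup>2)"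
proof -
  define t where "t = (of_bool b - of_bool (w {r, s})) / sqrt n"
  have "\<bar>t\<bar> \<le> 1 / sqrt n" unfolding t_def by (auto simp: of_bool_def)
  have "cmod (GG (w({r, s} := b)) i k - GG w i k) \<le> 2 * \<bar>t\<bar> / y\<^sup>2"
    by (rule resolvent_entry_perturbation[OF symmetric_wigner symmetric_wigner y ik rs])
       (simp add: wigner_flip[OF rs(3)] t_def)
  also have "\<dots> \<le> 2 * (1 / sqrt n) / y\<^sup>2"
    using \<open>\<bar>t\<bar> \<le> 1 / sqrt n\<close> by (intro divide_right_mono mult_left_mono) auto
  finally show ?thesis by simp
qed

lemma cmod_product_difference:
  assumes "cmod a \<le> A" "cmod d \<le> A" "cmod (a - c) \<le> \<epsilon>" "cmod (b - d) \<le> \<epsilon>"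
  shows "cmod (a * b - c * d) \<le> 2 * A * \<epsilon>"
proof -
  have "a * b - c * d = a * (b - d) + (a - c) * d" by (simp add: algebra_simps)
  also have "cmod \<dots> \<le> cmod a * cmod (b - d) + cmod (a - c) * cmod d"
    by (rule order_trans[OF norm_triangle_ineq]) (simp add: norm_mult)
  also have "\<dots> \<le> A * \<epsilon> + \<epsilon> * A"
    using assms order_trans[OF norm_ge_zero assms(1)] order_trans[OF norm_ge_zero assms(3)]
    by (intro add_mono mult_mono) auto
  finally show ?thesis by simp
qed

text \<open>
  Integration by parts produces products of entries of the two resolvents with the coin \<open>{i, j}\<close> set to
  true and to false. Each of them is within \<open>O(1 / \<surd>n)\<close> of the resolvent for the given coins.
\<close>

lemma entry_integration_by_parts:
  assumes ij: "i < n" "j < n" "i \<noteq> j"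
  shows "cmod (EE (\<lambda>w. complex_of_real (wigner n p w i j) * GG w j i) +
      complex_of_real (p * (1 - p) / n) * EE (\<lambda>w. (GG w j i)\<^sup>2 + GG w j j * GG w i i))
    \<le> 1 / n * (8 / (sqrt n * y ^ 3))"
proof -
  let ?e = "{i, j}"
  let ?R = "\<lambda>w. GG (w(?e := True)) j i * GG (w(?e := False)) j i + GG (w(?e := True)) j j * GG (w(?e := False)) i i"
  have diff: "GG (w(?e := True)) j i - GG (w(?e := False)) j i = - complex_of_real (1 / sqrt n) * ?R w" for w
  proof (rule resolvent_entry_change[OF symmetric_wigner symmetric_wigner y ij(2,1) ij])
    show "wigner n p (w(?e := True)) k h = wigner n p (w(?e := False)) k h + (if {k, h} = ?e then 1 / sqrt n else 0)" for k h
      using wigner_flip[OF ij(3), of n p "w(?e := False)" True k h] by simp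
  qed
  have "EE (\<lambda>w. complex_of_real (wigner n p w i j) * GG w j i) =
      EE (\<lambda>w. complex_of_real (1 / sqrt n) * ((of_bool (w ?e) - p) *\<^sub>R GG w j i))"
    using ij by (intro arg_cong[of _ _ "EE"] ext) (simp add: wigner_def scaleR_conv_of_real)
  also have "\<dots> = complex_of_real (1 / sqrt n) * EE (\<lambda>w. (of_bool (w ?e) - p) *\<^sub>R GG w j i)"
    by (rule integral_mult_right_zero)
  also have "EE (\<lambda>w. (of_bool (w ?e) - p) *\<^sub>R GG w j i) =
      (p * (1 - p)) *\<^sub>R EE (\<lambda>w. GG (w(?e := True)) j i - GG (w(?e := False)) j i)"
    by (rule coins_integration_by_parts[OF finite_edges edges_doubleton[OF ij] p])
  also have "\<dots> = (p * (1 - p)) *\<^sub>R (- complex_of_real (1 / sqrt n) * EE ?R)"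
    unfolding diff integral_mult_right_zero ..
  also have "complex_of_real (1 / sqrt n) * \<dots> = - complex_of_real (p * (1 - p) / n) * EE ?R"
  proof -
    have "complex_of_real (1 / sqrt n) * complex_of_real (1 / sqrt n) = complex_of_real (1 / n)"
      unfolding of_real_mult[symmetric] by simp
    thus ?thesis by (simp add: scaleR_conv_of_real)
  qed
  finally have eq: "EE (\<lambda>w. complex_of_real (wigner n p w i j) * GG w j i) +
      complex_of_real (p * (1 - p) / n) * EE (\<lambda>w. (GG w j i)\<^sup>2 + GG w j j * GG w i i) =
      complex_of_real (p * (1 - p) / n) * EE (\<lambda>w. (GG w j i)\<^sup>2 + GG w j j * GG w i i - ?R w)"
    unfolding Bochner_Integration.integral_diff[OF integrable_edges integrable_edges]
    by (simp add: algebra_simps)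
  have "cmod (complex_of_real (p * (1 - p) / n) * EE (\<lambda>w. (GG w j i)\<^sup>2 + GG w j j * GG w i i - ?R w)) =
      p * (1 - p) / n * cmod (EE (\<lambda>w. (GG w j i)\<^sup>2 + GG w j j * GG w i i - ?R w))"
    using p n by (simp only: norm_mult norm_of_real) simp
  also have "\<dots> \<le> 1 / n * (8 / (sqrt n * y ^ 3))"
  proof (rule mult_mono)
    have "p * (1 - p) \<le> 1" using p by (intro mult_le_one) auto
    thus "p * (1 - p) / n \<le> 1 / n" using n by (intro divide_right_mono) auto
    show "cmod (EE (\<lambda>w. (GG w j i)\<^sup>2 + GG w j j * GG w i i - ?R w)) \<le> 8 / (sqrt n * y ^ 3)"
    proof (rule norm_EE_le)
      fix w
      let ?\<epsilon> = "2 / (sqrt n * y\<^sup>2)"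
      define G G1 G0 where "G = GG w" and "G1 = GG (w(?e := True))" and "G0 = GG (w(?e := False))"
      have f: "cmod (G k h - G1 k h) \<le> ?\<epsilon>" "cmod (G k h - G0 k h) \<le> ?\<epsilon>" if "k < n" "h < n" for k h
        unfolding G_def G1_def G0_def using GG_flip_bound[OF ij that, of w]
        by (simp_all only: norm_minus_commute)
      have e: "cmod (G k h) \<le> 1 / y" "cmod (G0 k h) \<le> 1 / y" if "k < n" "h < n" for k h
        unfolding G_def G0_def using that by (simp_all only: GG_entry)
      have "(G j i)\<^sup>2 + G j j * G i i - (G1 j i * G0 j i + G1 j j * G0 i i) =
          (G j i * G j i - G1 j i * G0 j i) + (G j j * G i i - G1 j j * G0 i i)"
        by (simp add: power2_eq_square)
      also have "cmod \<dots> \<le> 2 * (1 / y) * ?\<epsilon> + 2 * (1 / y) * ?\<epsilon>"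
        by (intro order_trans[OF norm_triangle_ineq] add_mono cmod_product_difference e f ij)
      also have "\<dots> = 8 / (sqrt n * y ^ 3)"
        by (simp add: power2_eq_square power3_eq_cube)
      finally show "cmod ((GG w j i)\<^sup>2 + GG w j j * GG w i i - ?R w) \<le> 8 / (sqrt n * y ^ 3)"
        unfolding G_def G1_def G0_def .
    qed
  qed (use n in auto)
  finally show ?thesis unfolding eq .
qed

text \<open>
  The entrywise identities are summed over all \<open>i, j\<close>. On the left the trace of \<open>X G\<close> appears; on the
  right the products of diagonal entries add up to the square of the trace of \<open>G\<close>, while the squares of
  the entries are of lower order by the row norm bound.
\<close>

lemma approximate_semicircle_equation:
  "cmod (1 + \<i> * y * EE (stieltjes n p y) + complex_of_real (p * (1 - p)) * EE (\<lambda>w. (stieltjes n p y w)\<^sup>2))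
     \<le> 8 / (sqrt n * y ^ 3) + 3 / (n * y\<^sup>2)"
proof -
  let ?S = "stieltjes n p y"
  define c where "c = complex_of_real (p * (1 - p) / n)"
  define K where "K = 8 / (sqrt n * y ^ 3)"
  have K: "K \<ge> 0" unfolding K_def using y by simp
  have trS: "(\<Sum>i<n. GG w i i) = of_nat n * ?S w" for w unfolding stieltjes_def using n by simp
  have pp: "0 \<le> p * (1 - p)" "p * (1 - p) \<le> 1" using p by (auto intro: mult_le_one)
  have cn: "complex_of_real (p * (1 - p)) = of_nat n * c" unfolding c_def using n by simp
  have nc: "cmod c \<le> 1 / n" unfolding c_def norm_of_real using pp n by (simp add: divide_right_mono)
  define A where "A i j = EE (\<lambda>w. complex_of_real (wigner n p w i j) * GG w j i)" for i j
  define B where "B i j = EE (\<lambda>w. (GG w j i)\<^sup>2 + GG w j j * GG w i i)" for i j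
  have sumA: "(\<Sum>i<n. \<Sum>j<n. A i j) = of_nat n * (1 + \<i> * y * EE ?S)"
  proof -
    have "(\<Sum>i<n. \<Sum>j<n. A i j) = EE (\<lambda>w. \<Sum>i<n. \<Sum>j<n. complex_of_real (wigner n p w i j) * GG w j i)"
      unfolding A_def by (subst Bochner_Integration.integral_sum[OF integrable_edges],
        subst Bochner_Integration.integral_sum[OF integrable_edges]) (rule refl)
    also have "\<dots> = EE (\<lambda>w. of_nat n + of_nat n * (\<i> * y) * ?S w)"
    proof (intro arg_cong[of _ _ EE] ext)
      fix w
      have "(\<Sum>i<n. \<Sum>j<n. complex_of_real (wigner n p w i j) * GG w j i) = (\<Sum>i<n. \<i> * y * GG w i i + 1)"
        by (intro sum.cong refl) (simp add: resolvent_equation[OF symmetric_wigner y])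
      also have "\<dots> = \<i> * y * (\<Sum>i<n. GG w i i) + of_nat n" by (simp add: sum.distrib sum_distrib_left)
      finally show "(\<Sum>i<n. \<Sum>j<n. complex_of_real (wigner n p w i j) * GG w j i) = of_nat n + of_nat n * (\<i> * y) * ?S w"
        unfolding trS by simp
    qed
    also have "\<dots> = of_nat n + of_nat n * (\<i> * y) * EE ?S"
      by (subst Bochner_Integration.integral_add[OF integrable_edges integrable_edges]) simp
    finally show ?thesis by (simp add: algebra_simps)
  qed
  define Q where "Q = EE (\<lambda>w. \<Sum>i<n. \<Sum>j<n. (GG w j i)\<^sup>2)"
  have sumB: "(\<Sum>i<n. \<Sum>j<n. B i j) = Q + (of_nat n)\<^sup>2 * EE (\<lambda>w. (?S w)\<^sup>2)"
  proof -
    have "(\<Sum>i<n. \<Sum>j<n. B i j) = EE (\<lambda>w. \<Sum>i<n. \<Sum>j<n. (GG w j i)\<^sup>2 + GG w j j * GG w i i)"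
      unfolding B_def by (subst Bochner_Integration.integral_sum[OF integrable_edges],
        subst Bochner_Integration.integral_sum[OF integrable_edges]) (rule refl)
    also have "\<dots> = EE (\<lambda>w. (\<Sum>i<n. \<Sum>j<n. (GG w j i)\<^sup>2) + (of_nat n)\<^sup>2 * (?S w)\<^sup>2)"
    proof (intro arg_cong[of _ _ EE] ext)
      fix w
      have "(\<Sum>i<n. \<Sum>j<n. GG w j j * GG w i i) = (\<Sum>i<n. GG w i i) * (\<Sum>i<n. GG w i i)"
        by (simp add: sum_product mult.commute)
      thus "(\<Sum>i<n. \<Sum>j<n. (GG w j i)\<^sup>2 + GG w j j * GG w i i) = (\<Sum>i<n. \<Sum>j<n. (GG w j i)\<^sup>2) + (of_nat n)\<^sup>2 * (?S w)\<^sup>2"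
        unfolding trS by (simp add: sum.distrib power2_eq_square mult_ac)
    qed
    finally show ?thesis unfolding Q_def
      by (subst (asm) Bochner_Integration.integral_add[OF integrable_edges integrable_edges]) simp
  qed
  have Q: "cmod Q \<le> n / y\<^sup>2" unfolding Q_def
  proof (rule norm_EE_le)
    fix w
    have "cmod (\<Sum>i<n. \<Sum>j<n. (GG w j i)\<^sup>2) \<le> (\<Sum>i<n. 1 / y\<^sup>2)"
    proof (rule sum_norm_le)
      fix i assume "i \<in> {..<n}"
      hence "(\<Sum>j<n. (cmod (GG w i j))\<^sup>2) \<le> 1 / y\<^sup>2"
        by (intro resolvent_row_norm[OF symmetric_wigner y]) simp
      moreover have "cmod (\<Sum>j<n. (GG w j i)\<^sup>2) \<le> (\<Sum>j<n. (cmod (GG w i j))\<^sup>2)"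
        by (rule sum_norm_le) (simp add: norm_power resolvent_sym[of n _ y i])
      ultimately show "cmod (\<Sum>j<n. (GG w j i)\<^sup>2) \<le> 1 / y\<^sup>2" by simp
    qed
    thus "cmod (\<Sum>i<n. \<Sum>j<n. (GG w j i)\<^sup>2) \<le> n / y\<^sup>2" by simp
  qed
  have D: "cmod (A i j + c * B i j) \<le> 1 / n * (K) + (if i = j then 2 / (n * y\<^sup>2) else 0)"
    if ij: "i < n" "j < n" for i j
    \<comment> \<open>\<open>X\<close> has zero diagonal, so for \<open>i = j\<close> the second summand is itself the error.\<close>
  proof (cases "i = j")
    case False
    thus ?thesis unfolding A_def B_def c_def K_def using entry_integration_by_parts[OF ij False] by simp
  next
    case True
    have "cmod (B i i) \<le> 2 / y\<^sup>2" unfolding B_def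
    proof (rule norm_EE_le)
      fix w
      have "cmod (GG w i i) * cmod (GG w i i) \<le> (1 / y) * (1 / y)"
        using y ij by (intro mult_mono GG_entry) auto
      hence "cmod (GG w i i * GG w i i) \<le> 1 / y\<^sup>2" by (simp add: norm_mult power2_eq_square)
      thus "cmod ((GG w i i)\<^sup>2 + GG w i i * GG w i i) \<le> 2 / y\<^sup>2"
        unfolding power2_eq_square by (intro order_trans[OF norm_triangle_ineq]) simp
    qed
    hence "cmod (c * B i i) \<le> 1 / n * (2 / y\<^sup>2)"
      unfolding norm_mult using nc by (intro mult_mono) auto
    also have "\<dots> \<le> 1 / n * K + 2 / (n * y\<^sup>2)" using K by simp
    finally have "cmod (c * B i i) \<le> 1 / n * K + 2 / (n * y\<^sup>2)" .
    moreover have "A i i = 0" unfolding A_def wigner_def by simp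
    ultimately show ?thesis using True by simp
  qed
  define Z where "Z = 1 + \<i> * y * EE ?S + complex_of_real (p * (1 - p)) * EE (\<lambda>w. (?S w)\<^sup>2)"
  have Z: "of_nat n * Z = (\<Sum>i<n. \<Sum>j<n. A i j + c * B i j) - c * Q"
    unfolding sum.distrib sum_distrib_left[symmetric] sumA sumB Z_def cn
    by (simp add: algebra_simps power2_eq_square)
  have "n * cmod Z = cmod (of_nat n * Z)" by (simp only: norm_mult norm_of_nat)
  also have "\<dots> = cmod ((\<Sum>i<n. \<Sum>j<n. A i j + c * B i j) - c * Q)" by (simp only: Z)
  also have "\<dots> \<le> cmod (\<Sum>i<n. \<Sum>j<n. A i j + c * B i j) + cmod (c * Q)" by (rule norm_triangle_ineq4)
  also have "cmod (\<Sum>i<n. \<Sum>j<n. A i j + c * B i j) \<le>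
      (\<Sum>i<n. \<Sum>j<n. 1 / n * K + (if i = j then 2 / (n * y\<^sup>2) else 0))"
    by (intro sum_norm_le D) auto
  also have "cmod (c * Q) \<le> 1 / n * (n / y\<^sup>2)"
    unfolding norm_mult using nc Q by (intro mult_mono) auto
  also have "(\<Sum>i<n. \<Sum>j<n. 1 / n * K + (if i = j then 2 / (n * y\<^sup>2) else 0)) = n * K + 2 / y\<^sup>2"
    using n by (simp add: sum.distrib distrib_left)
  also have "n * K + 2 / y\<^sup>2 + 1 / n * (n / y\<^sup>2) = n * (K + 3 / (n * y\<^sup>2))"
    using n by (simp add: distrib_left)
  finally have "n * cmod Z \<le> n * (K + 3 / (n * y\<^sup>2))" by simp
  hence "cmod Z \<le> K + 3 / (n * y\<^sup>2)" using n by (simp only: mult_le_cancel_left_pos of_nat_0_less_iff)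
  thus ?thesis unfolding K_def Z_def .
qed

text \<open>
  The deviation of \<open>S\<close> from its mean is controlled by the variance, that of the mean from \<open>\<i> g\<close> by
  the stability of the semicircle equation.
\<close>

lemma stieltjes_in_mean:
  assumes p': "0 < p" "p < 1"
  shows "EE (\<lambda>w. cmod (stieltjes n p y w - \<i> * semicircle_g (sqrt (p * (1 - p))) y)) \<le>
    (1 / sqrt n + 4 / (sqrt n * y ^ 4)) / 2 + (8 / (sqrt n * y ^ 3) + 3 / (n * y\<^sup>2) + 4 / (n * y ^ 4)) / y"
proof -
  let ?S = "stieltjes n p y"
  define m where "m = EE ?S"
  define s where "s = sqrt (p * (1 - p))"
  have s: "s > 0" "s\<^sup>2 = p * (1 - p)" unfolding s_def using p' by auto
  have pp: "p * (1 - p) \<le> 1" using p by (intro mult_le_one) auto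
  define V where "V = EE (\<lambda>w. (cmod (?S w - m))\<^sup>2)"
  have V: "V \<le> 4 / (n * y ^ 4)" unfolding V_def m_def by (rule stieltjes_variance)
  have V0: "V \<ge> 0" unfolding V_def by (rule Bochner_Integration.integral_nonneg) simp
  have sq: "EE (\<lambda>w. (?S w)\<^sup>2) = m\<^sup>2 + EE (\<lambda>w. (?S w - m)\<^sup>2)"
  proof -
    have "EE (\<lambda>w. (?S w)\<^sup>2) = EE (\<lambda>w. (?S w - m)\<^sup>2 + (2 * m * ?S w - m\<^sup>2))"
      by (intro arg_cong[of _ _ EE] ext) (simp add: power2_eq_square algebra_simps)
    also have "\<dots> = EE (\<lambda>w. (?S w - m)\<^sup>2) + (2 * m * EE ?S - m\<^sup>2)"
      by (simp add: Bochner_Integration.integral_add[OF integrable_edges integrable_edges]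
          Bochner_Integration.integral_diff[OF integrable_edges integrable_edges])
    finally show ?thesis by (simp add: m_def[symmetric] power2_eq_square)
  qed
  have VE: "cmod (EE (\<lambda>w. (?S w - m)\<^sup>2)) \<le> V"
    unfolding V_def by (rule order_trans[OF integral_norm_bound]) (simp add: norm_power)
  have err: "cmod (complex_of_real (s\<^sup>2) * EE (\<lambda>w. (?S w - m)\<^sup>2)) \<le> 4 / (n * y ^ 4)"
  proof -
    have "cmod (complex_of_real (s\<^sup>2) * EE (\<lambda>w. (?S w - m)\<^sup>2)) = s\<^sup>2 * cmod (EE (\<lambda>w. (?S w - m)\<^sup>2))"
      by (simp only: norm_mult norm_of_real abs_power2)
    also have "s\<^sup>2 * cmod (EE (\<lambda>w. (?S w - m)\<^sup>2)) \<le> 1 * (4 / (n * y ^ 4))"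
      using V V0 pp s VE by (intro mult_mono) auto
    finally show ?thesis by simp
  qed
  have "1 + \<i> * y * m + s\<^sup>2 * m\<^sup>2 =
      (1 + \<i> * y * EE ?S + complex_of_real (p * (1 - p)) * EE (\<lambda>w. (?S w)\<^sup>2)) - complex_of_real (s\<^sup>2) * EE (\<lambda>w. (?S w - m)\<^sup>2)"
    unfolding sq s(2)[symmetric] m_def[symmetric] by (simp add: algebra_simps)
  hence "cmod (1 + \<i> * y * m + s\<^sup>2 * m\<^sup>2) \<le>
      cmod (1 + \<i> * y * EE ?S + complex_of_real (p * (1 - p)) * EE (\<lambda>w. (?S w)\<^sup>2)) +
      cmod (complex_of_real (s\<^sup>2) * EE (\<lambda>w. (?S w - m)\<^sup>2))"
    by (simp only: norm_triangle_ineq4)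
  also have "\<dots> \<le> 8 / (sqrt n * y ^ 3) + 3 / (n * y\<^sup>2) + 4 / (n * y ^ 4)"
    by (intro add_mono approximate_semicircle_equation err)
  finally have eq: "cmod (1 + \<i> * y * m + s\<^sup>2 * m\<^sup>2) \<le> 8 / (sqrt n * y ^ 3) + 3 / (n * y\<^sup>2) + 4 / (n * y ^ 4)" .
  have "Im m = EE (\<lambda>w. Im (?S w))" unfolding m_def by (rule integral_Im[symmetric, OF integrable_edges])
  moreover have "Im (?S w) \<ge> 0" for w
    unfolding stieltjes_def Im_divide_of_nat Im_resolvent_trace[OF symmetric_wigner]
    using y by (intro divide_nonneg_nonneg sum_nonneg) auto
  ultimately have "Im m \<ge> 0" by (simp add: Bochner_Integration.integral_nonneg)
  from semicircle_equation_stability[OF s(1) y this] eq[unfolded of_real_power]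
  have mg: "cmod (m - \<i> * semicircle_g s y) \<le> (8 / (sqrt n * y ^ 3) + 3 / (n * y\<^sup>2) + 4 / (n * y ^ 4)) / y"
    using y by (meson divide_right_mono less_imp_le order_trans)
  have "EE (\<lambda>w. cmod (?S w - \<i> * semicircle_g s y)) \<le>
      EE (\<lambda>w. (1 / sqrt n + sqrt n * (cmod (?S w - m))\<^sup>2) / 2 + cmod (m - \<i> * semicircle_g s y))"
  proof (rule integral_mono[OF integrable_edges integrable_edges])
    fix w
    \<comment> \<open>The weight \<open>r = \<surd>n\<close> balances the variance, which is of order \<open>1 / n\<close>.\<close>
    from two_mult_le_weighted[of "sqrt n" "cmod (?S w - m)"]
    have "cmod (?S w - m) \<le> (1 / sqrt n + sqrt n * (cmod (?S w - m))\<^sup>2) / 2" using n by simp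
    moreover have "cmod (?S w - \<i> * semicircle_g s y) \<le> cmod (?S w - m) + cmod (m - \<i> * semicircle_g s y)"
      using norm_triangle_ineq[of "?S w - m" "m - \<i> * semicircle_g s y"] by simp
    ultimately show "cmod (?S w - \<i> * semicircle_g s y) \<le>
      (1 / sqrt n + sqrt n * (cmod (?S w - m))\<^sup>2) / 2 + cmod (m - \<i> * semicircle_g s y)" by linarith
  qed
  also have "\<dots> = (1 / sqrt n + sqrt n * V) / 2 + cmod (m - \<i> * semicircle_g s y)"
    unfolding V_def by (simp add: Bochner_Integration.integral_add[OF integrable_edges integrable_edges])
  also have "\<dots> \<le> (1 / sqrt n + sqrt n * (4 / (n * y ^ 4))) / 2 + (8 / (sqrt n * y ^ 3) + 3 / (n * y\<^sup>2) + 4 / (n * y ^ 4)) / y"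
    using V mg by (intro add_mono divide_right_mono mult_left_mono order_refl) auto
  also have "sqrt n * (4 / (n * y ^ 4)) = 4 / (sqrt n * y ^ 4)"
  proof -
    have "R * (4 / (R * R * y ^ 4)) = 4 / (R * y ^ 4)" if "R > 0" for R :: real
      using that by simp
    from this[of "sqrt n"] show ?thesis using n by simp
  qed
  finally show ?thesis unfolding s_def .
qed

end

section \<open>The energy of the centred matrix\<close>

definition spectral_average :: "nat \<Rightarrow> real \<Rightarrow> (nat set \<Rightarrow> bool) \<Rightarrow> real \<Rightarrow> real" where
  "spectral_average n p w y = (\<Sum>k<n. (eigenvals n (wigner n p w) k)\<^sup>2 / ((eigenvals n (wigner n p w) k)\<^sup>2 + y\<^sup>2)) / n"

lemma sum_eigenvals_wigner_squared:
  assumes p: "0 \<le> p" "p \<le> 1"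
  shows "(\<Sum>k<n. (eigenvals n (wigner n p w) k)\<^sup>2) \<le> n"
proof (cases "n = 0")
  case False
  have "(\<Sum>k<n. (eigenvals n (wigner n p w) k)\<^sup>2) = (\<Sum>i<n. \<Sum>j<n. (wigner n p w i j)\<^sup>2)"
    by (rule spectral_frobenius[symmetric, OF spectral_eigenvals[OF symmetric_wigner]])
  also have "\<dots> \<le> (\<Sum>i<n. \<Sum>j<n. 1 / n)"
  proof (intro sum_mono)
    fix i j
    have "(of_bool (w {i, j}) - p)\<^sup>2 \<le> 1" using p by (cases "w {i, j}") (auto simp: abs_square_le_1)
    thus "(wigner n p w i j)\<^sup>2 \<le> 1 / n" unfolding wigner_def
      by (auto simp: power_divide divide_right_mono)
  qed
  also have "\<dots> = n" using False by simp
  finally show ?thesis .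
qed simp

lemma spectral_average_nonneg: "0 \<le> spectral_average n p w y"
  unfolding spectral_average_def by (intro divide_nonneg_nonneg sum_nonneg) auto

lemma spectral_average_bound:
  assumes p: "0 \<le> p" "p \<le> 1"
  shows "spectral_average n p w y \<le> 2 / (1 + y\<^sup>2)"
proof (cases "n = 0")
  case True
  thus ?thesis by (simp add: spectral_average_def add_nonneg_nonneg)
next
  case False
  let ?l = "eigenvals n (wigner n p w)"
  have "x / (x + z) \<le> (1 + x) / (1 + z)" if "x \<ge> 0" "z \<ge> 0" for x z :: real
  proof (cases "x + z = 0")
    case False
    hence "x + z > 0" using that by simp
    moreover have "x * (1 + z) \<le> (1 + x) * (x + z)"
      using that by (simp add: algebra_simps)
    ultimately show ?thesis using that by (simp add: divide_simps add_pos_nonneg mult_ac)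
  qed (use that in auto)
  from this[of "(?l _)\<^sup>2" "y\<^sup>2"]
  have "(\<Sum>k<n. (?l k)\<^sup>2 / ((?l k)\<^sup>2 + y\<^sup>2)) \<le> (\<Sum>k<n. (1 + (?l k)\<^sup>2) / (1 + y\<^sup>2))"
    by (intro sum_mono) auto
  also have "\<dots> = (n + (\<Sum>k<n. (?l k)\<^sup>2)) / (1 + y\<^sup>2)"
    by (simp add: sum_divide_distrib[symmetric] sum.distrib)
  also have "\<dots> \<le> (n + n) / (1 + y\<^sup>2)"
    using sum_eigenvals_wigner_squared[OF p, of n w]
    by (intro divide_right_mono add_left_mono) (auto simp: add_nonneg_nonneg)
  finally have "spectral_average n p w y \<le> (n + n) / (1 + y\<^sup>2) / n"
    unfolding spectral_average_def by (intro divide_right_mono) auto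
  also have "\<dots> = 2 / (1 + y\<^sup>2)" using False by (simp add: add_divide_distrib)
  finally show ?thesis .
qed

lemma spectral_average_stieltjes:
  assumes "n > 0" and y: "y > 0"
  shows "spectral_average n p w y = 1 - y * Im (stieltjes n p y w)"
proof -
  let ?l = "eigenvals n (wigner n p w)"
  have "y * Im (stieltjes n p y w) = (\<Sum>k<n. y * (y / ((?l k)\<^sup>2 + y\<^sup>2))) / n"
    unfolding stieltjes_def Im_divide_of_nat Im_resolvent_trace[OF symmetric_wigner]
    by (simp add: sum_distrib_left)
  moreover have "y * (y / ((?l k)\<^sup>2 + y\<^sup>2)) = 1 - (?l k)\<^sup>2 / ((?l k)\<^sup>2 + y\<^sup>2)" for k
  proof -
    have "(?l k)\<^sup>2 + y\<^sup>2 > 0" using y by (simp add: add_nonneg_pos)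
    hence "1 - (?l k)\<^sup>2 / ((?l k)\<^sup>2 + y\<^sup>2) = ((?l k)\<^sup>2 + y\<^sup>2 - (?l k)\<^sup>2) / ((?l k)\<^sup>2 + y\<^sup>2)"
      using y by (simp only: diff_divide_distrib) simp
    thus ?thesis by (simp add: power2_eq_square)
  qed
  ultimately have "y * Im (stieltjes n p y w) = (\<Sum>k<n. 1 - (?l k)\<^sup>2 / ((?l k)\<^sup>2 + y\<^sup>2)) / n" by simp
  also have "\<dots> = 1 - spectral_average n p w y"
    unfolding spectral_average_def sum_subtractf diff_divide_distrib using assms by simp
  finally show ?thesis by simp
qed

lemma energy_eq_integral:
  "has_bochner_integral lborel (\<lambda>y. spectral_average n p w y * indicator {0..} y)
     (pi / 2 * (array_energy n (wigner n p w) / n))"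
proof -
  let ?l = "eigenvals n (wigner n p w)"
  have "has_bochner_integral lborel (\<lambda>y. (\<Sum>k<n. (?l k)\<^sup>2 / ((?l k)\<^sup>2 + y\<^sup>2) * indicator {0..} y) / n) ((\<Sum>k<n. pi / 2 * \<bar>?l k\<bar>) / n)"
    by (intro has_bochner_integral_divide_zero has_bochner_integral_sum abs_eq_integral)
  moreover have "(\<lambda>y. (\<Sum>k<n. (?l k)\<^sup>2 / ((?l k)\<^sup>2 + y\<^sup>2) * indicator {0..} y) / n) = (\<lambda>y. spectral_average n p w y * indicator {0..} y)"
    by (auto simp: spectral_average_def sum_distrib_right fun_eq_iff)
  moreover have "(\<Sum>k<n. pi / 2 * \<bar>?l k\<bar>) / n = pi / 2 * (array_energy n (wigner n p w) / n)"
    unfolding array_energy_spectral[OF spectral_eigenvals[OF symmetric_wigner]] sum_distrib_left[symmetric] by simp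
  ultimately show ?thesis by (simp only:)
qed

lemma spectral_average_tendsto:
  assumes p: "0 < p" "p < 1" and y: "y > 0"
  shows "(\<lambda>n. measure_pmf.expectation (coins (edges n) p)
      (\<lambda>w. \<bar>spectral_average n p w y - (1 - y * semicircle_g (sqrt (p * (1 - p))) y)\<bar>)) \<longlonglongrightarrow> 0"
proof -
  let ?g = "semicircle_g (sqrt (p * (1 - p))) y"
  let ?r = "\<lambda>n::nat. y * ((1 / sqrt n + 4 / (sqrt n * y ^ 4)) / 2 + (8 / (sqrt n * y ^ 3) + 3 / (n * y\<^sup>2) + 4 / (n * y ^ 4)) / y)"
  have lim: "?r \<longlonglongrightarrow> 0" using y by real_asymp
  have le: "measure_pmf.expectation (coins (edges n) p) (\<lambda>w. \<bar>spectral_average n p w y - (1 - y * ?g)\<bar>) \<le> ?r n"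
    if n: "n > 0" for n
  proof -
    have "measure_pmf.expectation (coins (edges n) p) (\<lambda>w. \<bar>spectral_average n p w y - (1 - y * ?g)\<bar>) \<le>
      measure_pmf.expectation (coins (edges n) p) (\<lambda>w. y * cmod (stieltjes n p y w - \<i> * ?g))"
    proof (rule integral_mono[OF integrable_coins[OF finite_edges] integrable_coins[OF finite_edges]])
      fix w
      have "spectral_average n p w y - (1 - y * ?g) = - y * Im (stieltjes n p y w - \<i> * ?g)"
        unfolding spectral_average_stieltjes[OF n y] by (simp add: algebra_simps)
      also have "\<bar>\<dots>\<bar> = y * \<bar>Im (stieltjes n p y w - \<i> * ?g)\<bar>"
        using y by (subst abs_mult) simp
      also have "\<dots> \<le> y * cmod (stieltjes n p y w - \<i> * ?g)"
        using y by (intro mult_left_mono abs_Im_le_cmod) auto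
      finally show "\<bar>spectral_average n p w y - (1 - y * ?g)\<bar> \<le> y * cmod (stieltjes n p y w - \<i> * ?g)" .
    qed
    also have "\<dots> = y * measure_pmf.expectation (coins (edges n) p) (\<lambda>w. cmod (stieltjes n p y w - \<i> * ?g))"
      by (rule integral_mult_right_zero)
    also have "\<dots> \<le> ?r n"
      using y p n by (intro mult_left_mono stieltjes_in_mean) auto
    finally show ?thesis .
  qed
  show ?thesis
    by (rule tendsto_sandwich[OF _ _ tendsto_const lim])
      (auto intro!: always_eventually eventually_sequentiallyI[of 1] le Bochner_Integration.integral_nonneg)
qed

text \<open>
  The spectral averages converge in mean at every \<open>y > 0\<close> and are dominated by \<open>2 / (1 + y\<^sup>2)\<close>, so their
  integrals converge; these are the energies up to the factor \<open>\<pi> / 2\<close>.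
\<close>

lemma wigner_energy_in_mean:
  assumes p: "0 < p" "p < 1"
  shows "(\<lambda>n. measure_pmf.expectation (coins (edges n) p)
      (\<lambda>w. \<bar>array_energy n (wigner n p w) / n - 8 / (3 * pi) * sqrt (p * (1 - p))\<bar>)) \<longlonglongrightarrow> 0"
proof -
  define s where "s = sqrt (p * (1 - p))"
  have s: "s > 0" unfolding s_def using p by simp
  define H where "H y = (1 - y * semicircle_g s y) * indicator {0..} y" for y
  define h where "h n w y = spectral_average n p w y * indicator {0..} y" for n w y
  define B where "B y = 2 * (1\<^sup>2 / (1\<^sup>2 + y\<^sup>2) * indicator {0..} y)" for y :: real
  have H: "has_bochner_integral lborel H (4 * s / 3)"
    unfolding H_def by (rule semicircle_integral[OF s])
  have h: "has_bochner_integral lborel (h n w) (pi / 2 * (array_energy n (wigner n p w) / n))" for n w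
    unfolding h_def by (rule energy_eq_integral)
  have "has_bochner_integral lborel B (2 * (pi / 2 * \<bar>1\<bar>))"
    unfolding B_def by (intro has_bochner_integral_mult_right abs_eq_integral)
  hence B: "integrable lborel B" by (rule integrable.intros)
  have "(\<lambda>n. measure_pmf.expectation (coins (edges n) p) (\<lambda>w. \<bar>(\<integral>y. h n w y \<partial>lborel) - (\<integral>y. H y \<partial>lborel)\<bar>)) \<longlonglongrightarrow> 0"
  proof (rule integral_convergence_in_mean[OF _ _ _ B])
    show "finite (set_pmf (coins (edges n) p))" for n by (rule finite_set_pmf_coins[OF finite_edges])
    show "h n w \<in> borel_measurable lborel" for n w using h by (rule borel_measurable_has_bochner_integral)
    show "\<bar>h n w y\<bar> \<le> B y" for n w y
      unfolding h_def B_def using spectral_average_bound[of p n w y] spectral_average_nonneg[of n p w y] p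
      by (auto split: split_indicator)
    show "integrable lborel H" using H by (rule integrable.intros)
    have conv: "(\<lambda>n. measure_pmf.expectation (coins (edges n) p) (\<lambda>w. \<bar>h n w y - H y\<bar>)) \<longlonglongrightarrow> 0" if "y \<noteq> 0" for y
    proof (cases "y > 0")
      case True
      thus ?thesis unfolding h_def H_def s_def using spectral_average_tendsto[OF p True] by simp
    next
      case False
      thus ?thesis unfolding h_def H_def using that by simp
    qed
    show "AE y in lborel. (\<lambda>n. measure_pmf.expectation (coins (edges n) p) (\<lambda>w. \<bar>h n w y - H y\<bar>)) \<longlonglongrightarrow> 0"
      by (rule AE_mp[OF AE_lborel_singleton[of 0] AE_I2]) (use conv in auto)
  qed
  hence "(\<lambda>n. 2 / pi * measure_pmf.expectation (coins (edges n) p)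
      (\<lambda>w. \<bar>pi / 2 * (array_energy n (wigner n p w) / n) - 4 * s / 3\<bar>)) \<longlonglongrightarrow> 2 / pi * 0"
    unfolding has_bochner_integral_integral_eq[OF h] has_bochner_integral_integral_eq[OF H] by (rule tendsto_mult_left)
  moreover have key: "2 / pi * \<bar>pi / 2 * x - 4 * s / 3\<bar> = \<bar>x - 8 / (3 * pi) * s\<bar>" for x
  proof -
    have "2 / pi * \<bar>pi / 2 * x - 4 * s / 3\<bar> = \<bar>2 / pi * (pi / 2 * x - 4 * s / 3)\<bar>" by (subst abs_mult) simp
    also have "2 / pi * (pi / 2 * x - 4 * s / 3) = x - 8 / (3 * pi) * s" by (simp add: field_simps)
    finally show ?thesis .
  qed
  ultimately show ?thesis
    unfolding s_def[symmetric] integral_mult_right_zero[symmetric] key mult_zero_right by (simp only:)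
qed

section \<open>Distances in the random graph\<close>

abbreviation coin_graph :: "nat \<Rightarrow> (nat set \<Rightarrow> bool) \<Rightarrow> nat pair_pre_digraph" where
  "coin_graph n w \<equiv> \<lparr>pverts = {..<n}, parcs = {(u, v). w {u, v}}\<rparr>"

lemma coins_support:
  assumes "w \<in> set_pmf (coins (edges n) p)" "w e"
  shows "e \<in> edges n"
  using assms set_Pi_pmf_subset[OF finite_edges, of n False "\<lambda>_. bernoulli_pmf p"] by blast

definition harary_entry :: "nat \<Rightarrow> (nat set \<Rightarrow> bool) \<Rightarrow> nat \<Rightarrow> nat \<Rightarrow> real" where
  "harary_entry n w i j = (if i = j then 0 else 1 / real_of_ereal (graph_dist (coin_graph n w) i j))"

text \<open>
  Adjacent vertices may count as distant. This only enlarges the set of exceptional pairs, and it makes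
  the condition depend on the common neighbours alone.
\<close>

definition distant :: "nat \<Rightarrow> (nat set \<Rightarrow> bool) \<Rightarrow> nat \<Rightarrow> nat \<Rightarrow> bool" where
  "distant n w i j \<longleftrightarrow> i \<noteq> j \<and> \<not> (\<exists>k<n. w {i, k} \<and> w {k, j})"

context
  fixes n :: nat and w :: "nat set \<Rightarrow> bool"
  assumes w: "\<And>e. w e \<Longrightarrow> e \<in> edges n"
begin

lemma coin_vertices: "w {u, v} \<Longrightarrow> u < n \<and> v < n \<and> u \<noteq> v"
  using w[of "{u, v}"] by (auto simp: card_2_iff doubleton_eq_iff)

interpretation G: pair_sym_digraph "coin_graph n w"
  by unfold_locales
    (auto simp: coin_vertices symmetric_def insert_commute intro!: symI dest: coin_vertices)

lemma graph_dist_eq_Inf: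
  "graph_dist (coin_graph n w) u v = (INF q\<in>{q. G.awalk u q v}. ereal (length q))"
  unfolding graph_dist_def G.\<mu>_def G.awalk_cost_def by (simp add: sum_list_triv)

lemma graph_dist_sym: "graph_dist (coin_graph n w) u v = graph_dist (coin_graph n w) v u"
proof -
  have len: "length (rev_path q) = length q" for q :: "(nat \<times> nat) list" by (induction q) auto
  have "(INF q\<in>{q. G.awalk a q b}. ereal (length q)) \<le> (INF q\<in>{q. G.awalk b q a}. ereal (length q))" for a b
    by (rule INF_mono) (metis G.awalk_rev_path len mem_Collect_eq order_refl)
  thus ?thesis unfolding graph_dist_eq_Inf by (intro antisym)
qed

lemma graph_dist_ge_1: "u \<noteq> v \<Longrightarrow> 1 \<le> graph_dist (coin_graph n w) u v"
  unfolding graph_dist_eq_Inf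
proof (rule INF_greatest)
  fix q assume "u \<noteq> v" "q \<in> {q. G.awalk u q v}"
  hence "q \<noteq> []" by (auto simp: G.awalk_empty_ends)
  thus "1 \<le> ereal (real (length q))" by (cases q) (auto simp: one_ereal_def)
qed

lemma graph_dist_adjacent:
  assumes "w {u, v}"
  shows "graph_dist (coin_graph n w) u v = 1"
proof (rule antisym)
  have "G.awalk u [(u, v)] v" using assms coin_vertices[OF assms]
    by (auto simp: G.awalk_simps)
  hence "graph_dist (coin_graph n w) u v \<le> ereal (length [(u, v)])"
    unfolding graph_dist_eq_Inf by (intro INF_lower) simp
  thus "graph_dist (coin_graph n w) u v \<le> 1" by (simp add: one_ereal_def)
  show "1 \<le> graph_dist (coin_graph n w) u v" using coin_vertices[OF assms] by (intro graph_dist_ge_1) simp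
qed

lemma graph_dist_common_neighbour:
  assumes uv: "u \<noteq> v" "\<not> w {u, v}" and k: "w {u, k}" "w {k, v}"
  shows "graph_dist (coin_graph n w) u v = 2"
proof (rule antisym)
  have "G.awalk u [(u, k), (k, v)] v" using k coin_vertices[OF k(1)] coin_vertices[OF k(2)]
    by (auto simp: G.awalk_simps)
  hence "graph_dist (coin_graph n w) u v \<le> ereal (length [(u, k), (k, v)])"
    unfolding graph_dist_eq_Inf by (intro INF_lower) simp
  thus "graph_dist (coin_graph n w) u v \<le> 2" by simp
  show "2 \<le> graph_dist (coin_graph n w) u v"
    unfolding graph_dist_eq_Inf
  proof (rule INF_greatest)
    fix q assume q: "q \<in> {q. G.awalk u q v}"
    have "length q \<ge> 2"
    proof (cases q)
      case Nil
      thus ?thesis using q uv by (auto simp: G.awalk_empty_ends)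
    next
      case (Cons a q')
      thus ?thesis using q uv by (cases q') (auto simp: G.awalk_simps)
    qed
    thus "2 \<le> ereal (real (length q))" by simp
  qed
qed

lemma harary_energy_coin_graph: "harary_energy (coin_graph n w) = array_energy n (harary_entry n w)"
  unfolding harary_energy_def harary_matrix_def array_energy_def harary_entry_def by simp

lemma harary_entry_sym: "harary_entry n w i j = harary_entry n w j i"
  unfolding harary_entry_def using graph_dist_sym by auto

lemma harary_entry_bounds: "0 \<le> harary_entry n w i j" "harary_entry n w i j \<le> 1"
proof -
  have "0 \<le> harary_entry n w i j \<and> harary_entry n w i j \<le> 1"
  proof (cases "i = j")
    case False
    from graph_dist_ge_1[OF this] show ?thesis
      using False unfolding harary_entry_def
      by (cases "graph_dist (coin_graph n w) i j") (auto simp: one_ereal_def)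
  qed (simp add: harary_entry_def)
  thus "0 \<le> harary_entry n w i j" "harary_entry n w i j \<le> 1" by auto
qed

lemma harary_entry_approx:
  "\<bar>harary_entry n w i j - (if i = j then 0 else (1 + of_bool (w {i, j})) / 2)\<bar> \<le> of_bool (distant n w i j)"
proof (cases "i = j \<or> w {i, j} \<or> distant n w i j")
  case True
  consider "i = j" | "w {i, j}" "i \<noteq> j" | "distant n w i j" "\<not> w {i, j}" "i \<noteq> j" using True by blast
  thus ?thesis
  proof cases
    case 3
    thus ?thesis using harary_entry_bounds[of i j] by (simp add: abs_le_iff)
  qed (simp_all add: harary_entry_def graph_dist_adjacent)
next
  case False
  then obtain k where "w {i, k}" "w {k, j}" unfolding distant_def by auto
  thus ?thesis using False by (simp add: harary_entry_def graph_dist_common_neighbour)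
qed

end

text \<open>
  Chebyshev's inequality for the number \<open>N\<close> of common neighbours: its mean is \<open>(n - 2) p\<^sup>2\<close>, and
  as at most \<open>2 (n - 2)\<close> coins have influence, at most one each, its variance is \<open>O(n)\<close>. The resulting
  bound \<open>O(1 / n)\<close> is too weak to exclude distant pairs altogether, but the number of them only has to
  be \<open>o(n\<^sup>2)\<close>.
\<close>

lemma distant_probability:
  assumes p: "0 < p" "p < 1" and ij: "i < n" "j < n" "i \<noteq> j" and n: "n > 2"
  shows "measure_pmf.expectation (coins (edges n) p) (\<lambda>w. of_bool (distant n w i j)) \<le> 2 / (real (n - 2) * p ^ 4)"
proof -
  let ?E = "measure_pmf.expectation (coins (edges n) p)"
  note int = integrable_coins[OF finite_edges]
  define K where "K = {..<n} - {i, j}"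
  have K: "finite K" "card K = n - 2" unfolding K_def using ij by auto
  have Kin: "k < n" "k \<noteq> i" "k \<noteq> j" if "k \<in> K" for k using that unfolding K_def by auto
  define N :: "(nat set \<Rightarrow> bool) \<Rightarrow> real" where "N w = (\<Sum>k\<in>K. of_bool (w {i, k}) * of_bool (w {k, j}))" for w
  define m where "m = real (n - 2) * p\<^sup>2"
  have m0: "m > 0" unfolding m_def using n p by simp
  have "?E N = (\<Sum>k\<in>K. ?E (\<lambda>w. of_bool (w {i, k}) * of_bool (w {k, j})))"
    unfolding N_def by (rule Bochner_Integration.integral_sum) (rule int)
  also have "\<dots> = (\<Sum>k\<in>K. p\<^sup>2)"
  proof (intro sum.cong refl expectation_two_coins finite_edges)
    fix k assume k: "k \<in> K"
    show "{i, k} \<in> edges n" "{k, j} \<in> edges n" using Kin[OF k] ij by auto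
    show "{i, k} \<noteq> {k, j}" using Kin[OF k] ij by (auto simp: doubleton_eq_iff)
  qed (use p in auto)
  finally have EN: "?E N = m" unfolding m_def using K by simp
  define F where "F = (\<lambda>k. {i, k}) ` K \<union> (\<lambda>k. {k, j}) ` K"
  have F: "finite F" "card F \<le> 2 * (n - 2)"
  proof -
    show "finite F" unfolding F_def using K by auto
    have "card F \<le> card ((\<lambda>k. {i, k}) ` K) + card ((\<lambda>k. {k, j}) ` K)" unfolding F_def by (rule card_Un_le)
    also have "\<dots> \<le> card K + card K" using K(1) by (intro add_mono card_image_le)
    finally show "card F \<le> 2 * (n - 2)" using K by simp
  qed
  have diff: "norm (N (w(e := True)) - N (w(e := False))) \<le> of_bool (e \<in> F)" for w e
  proof -
    define x :: "nat \<Rightarrow> bool \<Rightarrow> real" where "x k b = of_bool ((w(e := b)) {i, k}) * of_bool ((w(e := b)) {k, j})" for k b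
    have eq: "N (w(e := True)) - N (w(e := False)) = (\<Sum>k\<in>K. x k True - x k False)"
      unfolding N_def x_def by (simp add: sum_subtractf)
    have x1: "\<bar>x k True - x k False\<bar> \<le> 1" for k unfolding x_def by auto
    show ?thesis
    proof (cases "e \<in> F")
      case False
      hence "x k True - x k False = 0" if "k \<in> K" for k
        using that unfolding F_def x_def by auto
      thus ?thesis unfolding eq by simp
    next
      case True
      then obtain k0 where k0: "k0 \<in> K" "e = {i, k0} \<or> e = {k0, j}" unfolding F_def by auto
      have "x k True - x k False = 0" if "k \<in> K" "k \<noteq> k0" for k
      proof -
        have "{i, k} \<noteq> e" "{k, j} \<noteq> e"
          using k0(2) that(2) Kin[OF that(1)] Kin[OF k0(1)] ij by (auto simp: doubleton_eq_iff)
        thus ?thesis unfolding x_def by simp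
      qed
      hence "(\<Sum>k\<in>K. x k True - x k False) = (\<Sum>k\<in>K. if k = k0 then x k0 True - x k0 False else 0)"
        by (intro sum.cong refl) auto
      also have "\<dots> = x k0 True - x k0 False" using K k0 by simp
      finally show ?thesis unfolding eq using x1[of k0] True by simp
    qed
  qed
  have "?E (\<lambda>w. (norm (N w - ?E N))\<^sup>2) \<le> (\<Sum>e\<in>edges n. (of_bool (e \<in> F))\<^sup>2)"
    by (rule efron_stein_coins[OF finite_edges _ _ diff]) (use p in auto)
  also have "(\<Sum>e\<in>edges n. (of_bool (e \<in> F))\<^sup>2) = (\<Sum>e\<in>edges n \<inter> F. 1 :: real)"
    by (rule sum.mono_neutral_cong_right) (use finite_edges[of n] in auto)
  also have "\<dots> \<le> card F" using F by (simp add: card_mono)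
  also have "\<dots> \<le> 2 * real (n - 2)" using F(2) by linarith
  finally have var: "?E (\<lambda>w. (N w - m)\<^sup>2) \<le> 2 * real (n - 2)" unfolding EN by simp
  have "?E (\<lambda>w. of_bool (distant n w i j)) \<le> ?E (\<lambda>w. (N w - m)\<^sup>2 / m\<^sup>2)"
  proof (rule integral_mono[OF int int])
    fix w
    show "of_bool (distant n w i j) \<le> (N w - m)\<^sup>2 / m\<^sup>2"
    proof (cases "distant n w i j")
      case True
      hence "N w = 0" unfolding N_def distant_def using Kin by (intro sum.neutral) auto
      thus ?thesis using m0 by simp
    qed simp
  qed
  also have "\<dots> = ?E (\<lambda>w. (N w - m)\<^sup>2) / m\<^sup>2" by (rule integral_divide_zero)
  also have "\<dots> \<le> 2 * real (n - 2) / m\<^sup>2" using var by (intro divide_right_mono) auto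
  also have "\<dots> = 2 / (real (n - 2) * p ^ 4)"
  proof -
    have "2 * M / (M * p\<^sup>2)\<^sup>2 = 2 / (M * p ^ 4)" if "M > 0" for M
      using that p by (simp add: field_simps power2_eq_square power4_eq_xxxx)
    from this[of "real (n - 2)"] show ?thesis unfolding m_def using n by simp
  qed
  finally show ?thesis .
qed

section \<open>The Harary energy\<close>

lemma array_energy_all_pairs_le:
  assumes c: "0 \<le> c"
  shows "array_energy n (\<lambda>i j. if i = j then 0 else c) \<le> 2 * c * n"
proof -
  have "array_energy n (\<lambda>i j. if i = j then 0 else c) \<le>
      array_energy n (\<lambda>i j. c * 1) + array_energy n (\<lambda>i j. if i = j then - c else 0)"
    by (rule array_energy_triangle) auto
  moreover have "array_energy n (\<lambda>i j. c * 1) = c * n"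
    using c by (subst array_energy_scale) (auto simp: array_energy_ones)
  moreover have "array_energy n (\<lambda>i j. if i = j then - c else 0) \<le> c * n"
  proof -
    have "(\<Sum>i<n. \<Sum>j<n. (if i = j then - c else 0)\<^sup>2) = (\<Sum>i<n. \<Sum>j<n. if i = j then c\<^sup>2 else 0)"
      by (intro sum.cong refl) auto
    also have "\<dots> = n * c\<^sup>2" by simp
    finally have "array_energy n (\<lambda>i j. if i = j then - c else 0) \<le> sqrt n * sqrt (n * c\<^sup>2)"
      using array_energy_le_frobenius[of n "\<lambda>i j. if i = j then - c else 0"] by simp
    also have "sqrt n * sqrt (n * c\<^sup>2) = sqrt n * sqrt n * c"
      using c by (simp only: real_sqrt_mult real_sqrt_abs abs_of_nonneg mult.assoc)
    finally show ?thesis by (simp add: mult.commute)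
  qed
  ultimately show ?thesis by simp
qed

text \<open>
  With \<open>x\<close> the scaled centred matrix, \<open>q\<close> its mean part and \<open>b\<close> the error from distant pairs, the
  Harary matrix is \<open>x + q + b\<close>, and the triangle inequality is used in both directions.
\<close>

lemma harary_energy_approx:
  assumes w: "\<And>e. w e \<Longrightarrow> e \<in> edges n" and p: "0 \<le> p" "p \<le> 1" and n: "n > 0"
  shows "\<bar>harary_energy (coin_graph n w) - sqrt n / 2 * array_energy n (wigner n p w)\<bar>
    \<le> sqrt n * sqrt (\<Sum>i<n. \<Sum>j<n. of_bool (distant n w i j)) + 2 * n"
proof -
  define r where "r = harary_entry n w"
  define x where "x i j = sqrt n / 2 * wigner n p w i j" for i j
  define q where "q i j = (if i = j then 0 else (1 + p) / 2)" for i j :: nat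
  define b where "b i j = r i j - (x i j + q i j)" for i j
  have rs: "r i j = r j i" for i j unfolding r_def by (rule harary_entry_sym[OF w])
  have xs: "x i j = x j i" for i j unfolding x_def wigner_def by (simp add: insert_commute)
  have qs: "q i j = q j i" for i j unfolding q_def by simp
  have bs: "b i j = b j i" for i j unfolding b_def using rs xs qs by metis
  have ideal: "x i j + q i j = (if i = j then 0 else (1 + of_bool (w {i, j})) / 2)" for i j
    using n unfolding x_def q_def wigner_def by (simp add: field_simps)
  have "(b i j)\<^sup>2 \<le> of_bool (distant n w i j)" for i j
  proof -
    have "\<bar>b i j\<bar> \<le> of_bool (distant n w i j)"
      unfolding b_def ideal r_def by (rule harary_entry_approx[OF w])
    hence "\<bar>b i j\<bar>\<^sup>2 \<le> (of_bool (distant n w i j))\<^sup>2" by (intro power_mono) auto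
    thus ?thesis by (cases "distant n w i j") auto
  qed
  hence "(\<Sum>i<n. \<Sum>j<n. (b i j)\<^sup>2) \<le> (\<Sum>i<n. \<Sum>j<n. of_bool (distant n w i j))" by (intro sum_mono)
  hence Eb: "array_energy n b \<le> sqrt n * sqrt (\<Sum>i<n. \<Sum>j<n. of_bool (distant n w i j))"
    by (intro order_trans[OF array_energy_le_frobenius] mult_left_mono real_sqrt_le_mono bs) auto
  have Eq: "array_energy n q \<le> 2 * n"
  proof -
    have "array_energy n q \<le> 2 * ((1 + p) / 2) * n"
      unfolding q_def using p by (intro array_energy_all_pairs_le) auto
    also have "\<dots> \<le> 2 * 1 * real n" using p by (intro mult_right_mono mult_left_mono) auto
    finally show ?thesis by simp
  qed
  have neg: "array_energy n (\<lambda>i j. - 1 * a i j) = array_energy n a" if "\<And>i j. a i j = a j i" for a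
    using that by (subst array_energy_scale) auto
  have c: "array_energy n (\<lambda>i j. b i j + q i j) \<le> array_energy n b + array_energy n q"
    using bs qs by (intro array_energy_triangle) auto
  have bqs: "b i j + q i j = b j i + q j i" for i j using bs qs by metis
  have "array_energy n r \<le> array_energy n x + array_energy n (\<lambda>i j. b i j + q i j)"
    using xs bqs by (intro array_energy_triangle) (auto simp: b_def)
  moreover have "array_energy n x \<le> array_energy n r + array_energy n (\<lambda>i j. - 1 * (b i j + q i j))"
    using rs bqs by (intro array_energy_triangle) (auto simp: b_def)
  moreover have "array_energy n x = sqrt n / 2 * array_energy n (wigner n p w)"
    unfolding x_def using symmetric_wigner[of n p w]
    by (subst array_energy_scale) (auto simp: symmetric_array_def)
  moreover have "harary_energy (coin_graph n w) = array_energy n r"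
    unfolding r_def by (rule harary_energy_coin_graph[OF w])
  ultimately show ?thesis using Eb Eq c neg[OF bqs] by (simp only: abs_le_iff) linarith
qed

text \<open>
  Markov's inequality with the square root of the mean as threshold. The summand \<open>1 / Suc n\<close> keeps the
  threshold positive.
\<close>

lemma convergence_in_mean_imp_in_probability:
  fixes P :: "nat \<Rightarrow> 'a pmf" and f :: "nat \<Rightarrow> 'a \<Rightarrow> real"
  assumes fin: "\<And>n. finite (set_pmf (P n))"
    and lim: "(\<lambda>n. measure_pmf.expectation (P n) (\<lambda>x. \<bar>f n x\<bar>)) \<longlonglongrightarrow> 0"
  shows "\<exists>\<epsilon>. \<epsilon> \<longlonglongrightarrow> 0 \<and> (\<lambda>n. measure_pmf.prob (P n) {x. \<bar>f n x\<bar> \<le> \<epsilon> n}) \<longlonglongrightarrow> 1"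
proof -
  define a where "a n = measure_pmf.expectation (P n) (\<lambda>x. \<bar>f n x\<bar>)" for n
  define \<epsilon> where "\<epsilon> n = sqrt (a n + 1 / Suc n)" for n
  have a0: "a n \<ge> 0" for n unfolding a_def by (rule Bochner_Integration.integral_nonneg) simp
  have pos: "\<epsilon> n > 0" for n unfolding \<epsilon>_def using a0[of n] by (simp add: add_nonneg_pos)
  have "\<epsilon> \<longlonglongrightarrow> sqrt (0 + 0)"
    unfolding \<epsilon>_def using lim unfolding a_def[symmetric]
    by (intro tendsto_intros LIMSEQ_Suc[OF lim_1_over_n]) auto
  hence \<epsilon>0: "\<epsilon> \<longlonglongrightarrow> 0" by simp
  have lower: "1 - \<epsilon> n \<le> measure_pmf.prob (P n) {x. \<bar>f n x\<bar> \<le> \<epsilon> n}" for n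
  proof -
    have "measure_pmf.prob (P n) {x. \<epsilon> n \<le> \<bar>f n x\<bar>} \<le> a n / \<epsilon> n"
      using integral_Markov_inequality_measure[of "P n" "\<lambda>x. \<bar>f n x\<bar>" "{}" "\<epsilon> n"] pos[of n]
      by (simp add: a_def integrable_measure_pmf_finite fin)
    also have "\<dots> \<le> (\<epsilon> n)\<^sup>2 / \<epsilon> n"
      using pos[of n] a0[of n] by (intro divide_right_mono) (auto simp: \<epsilon>_def add_nonneg_nonneg)
    also have "\<dots> = \<epsilon> n" by (simp add: power2_eq_square)
    finally have "measure_pmf.prob (P n) {x. \<epsilon> n \<le> \<bar>f n x\<bar>} \<le> \<epsilon> n" .
    moreover have "measure_pmf.prob (P n) (UNIV - {x. \<bar>f n x\<bar> \<le> \<epsilon> n}) \<le> measure_pmf.prob (P n) {x. \<epsilon> n \<le> \<bar>f n x\<bar>}"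
      by (intro measure_pmf.finite_measure_mono) auto
    moreover have "measure_pmf.prob (P n) (UNIV - {x. \<bar>f n x\<bar> \<le> \<epsilon> n}) = 1 - measure_pmf.prob (P n) {x. \<bar>f n x\<bar> \<le> \<epsilon> n}"
      using measure_pmf.prob_compl[of "{x. \<bar>f n x\<bar> \<le> \<epsilon> n}" "P n"] by simp
    ultimately show ?thesis by linarith
  qed
  have "(\<lambda>n. measure_pmf.prob (P n) {x. \<bar>f n x\<bar> \<le> \<epsilon> n}) \<longlonglongrightarrow> 1"
  proof (rule tendsto_sandwich)
    have "(\<lambda>n. 1 - \<epsilon> n) \<longlonglongrightarrow> 1 - 0" by (intro tendsto_intros \<epsilon>0)
    thus "(\<lambda>n. 1 - \<epsilon> n) \<longlonglongrightarrow> 1" by simp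
  qed (auto intro!: always_eventually lower measure_pmf.prob_le_1)
  thus ?thesis using \<epsilon>0 by blast
qed

text \<open>
  The factor \<open>1 / 2\<close> between the Harary matrix and the scaled centred matrix turns the constant
  \<open>8 / (3 \<pi>)\<close> into \<open>4 / (3 \<pi>)\<close>.
\<close>

lemma harary_energy_in_mean:
  assumes p: "0 < p" "p < 1"
  shows "(\<lambda>n. measure_pmf.expectation (erdos_renyi n p)
      (\<lambda>G. \<bar>harary_energy G / (n * sqrt n) - 4 / (3 * pi) * sqrt (p * (1 - p))\<bar>)) \<longlonglongrightarrow> 0"
proof -
  let ?E = "\<lambda>n. measure_pmf.expectation (coins (edges n) p)"
  let ?s = "sqrt (p * (1 - p))"
  define a where "a n = ?E n (\<lambda>w. \<bar>array_energy n (wigner n p w) / n - 8 / (3 * pi) * ?s\<bar>)" for n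
  have a: "a \<longlonglongrightarrow> 0" unfolding a_def by (rule wigner_energy_in_mean[OF p])
  let ?r = "\<lambda>n::nat. (1 / sqrt n + sqrt n * (2 / ((real n - 2) * p ^ 4))) / 2 + 2 / sqrt n + a n / 2"
  have "(\<lambda>n::nat. (1 / sqrt n + sqrt n * (2 / ((real n - 2) * p ^ 4))) / 2 + 2 / sqrt n) \<longlonglongrightarrow> 0"
    using p by real_asymp
  from tendsto_add[OF this tendsto_divide[OF a tendsto_const[of 2]]]
  have lim: "?r \<longlonglongrightarrow> 0" by simp
  have le: "measure_pmf.expectation (erdos_renyi n p) (\<lambda>G. \<bar>harary_energy G / (n * sqrt n) - 4 / (3 * pi) * ?s\<bar>) \<le> ?r n"
    if n: "n > 2" for n
  proof -
    note int = integrable_coins[OF finite_edges]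
    define Z :: "(nat set \<Rightarrow> bool) \<Rightarrow> real" where "Z w = (\<Sum>i<n. \<Sum>j<n. of_bool (distant n w i j))" for w
    have Z0: "Z w \<ge> 0" for w unfolding Z_def by (intro sum_nonneg) auto
    have "?E n Z = (\<Sum>i<n. \<Sum>j<n. ?E n (\<lambda>w. of_bool (distant n w i j)))"
      unfolding Z_def by (subst Bochner_Integration.integral_sum[OF int], subst Bochner_Integration.integral_sum[OF int]) (rule refl)
    also have "\<dots> \<le> (\<Sum>i<n. \<Sum>j<n. 2 / ((real n - 2) * p ^ 4))"
    proof (intro sum_mono)
      fix i j assume ij: "i \<in> {..<n}" "j \<in> {..<n}"
      show "?E n (\<lambda>w. of_bool (distant n w i j)) \<le> 2 / ((real n - 2) * p ^ 4)"
      proof (cases "i = j")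
        case True
        thus ?thesis using n p by (simp add: distant_def)
      next
        case False
        thus ?thesis using distant_probability[OF p _ _ False n] ij n by (simp add: of_nat_diff)
      qed
    qed
    finally have EZ: "?E n Z \<le> n * n * (2 / ((real n - 2) * p ^ 4))" by simp
    have "measure_pmf.expectation (erdos_renyi n p) (\<lambda>G. \<bar>harary_energy G / (n * sqrt n) - 4 / (3 * pi) * ?s\<bar>) =
        ?E n (\<lambda>w. \<bar>harary_energy (coin_graph n w) / (n * sqrt n) - 4 / (3 * pi) * ?s\<bar>)"
      unfolding erdos_renyi_def by simp
    also have "\<dots> \<le> ?E n (\<lambda>w. (1 / sqrt n + sqrt n * (Z w / (n * n))) / 2 + 2 / sqrt n +
        \<bar>array_energy n (wigner n p w) / n - 8 / (3 * pi) * ?s\<bar> / 2)"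
    proof (rule integral_mono_AE[OF int int], rule AE_pmfI)
      fix w assume "w \<in> set_pmf (coins (edges n) p)"
      hence w: "\<And>e. w e \<Longrightarrow> e \<in> edges n" by (rule coins_support)
      define X where "X = array_energy n (wigner n p w)"
      define T where "T = n * sqrt n"
      have T: "T > 0" unfolding T_def using n by simp
      have nn: "sqrt n * sqrt n = real n" by simp
      have "\<bar>harary_energy (coin_graph n w) - sqrt n / 2 * X\<bar> / T \<le> (sqrt n * sqrt (Z w) + 2 * n) / T"
        unfolding X_def Z_def using p n T by (intro divide_right_mono harary_energy_approx w) auto
      also have "\<dots> = sqrt (Z w) / n + 2 / sqrt n"
        unfolding T_def add_divide_distrib using n by simp
      also have "sqrt (Z w) / n \<le> (1 / sqrt n + sqrt n * (Z w / (n * n))) / 2"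
      proof -
        have "2 * (sqrt (Z w) / n) \<le> 1 / sqrt n + sqrt n * (Z w / (n * n))"
          using two_mult_le_weighted[of "sqrt n" "sqrt (Z w) / n"] n Z0[of w]
          by (simp add: power_divide power2_eq_square[of "real n"])
        moreover have "2 * a \<le> b \<Longrightarrow> a \<le> b / 2" for a b :: real by simp
        ultimately show ?thesis by blast
      qed
      finally have 1: "\<bar>harary_energy (coin_graph n w) - sqrt n / 2 * X\<bar> / T \<le>
          (1 / sqrt n + sqrt n * (Z w / (n * n))) / 2 + 2 / sqrt n" by simp
      have "harary_energy (coin_graph n w) / T - 4 / (3 * pi) * ?s =
          (harary_energy (coin_graph n w) - sqrt n / 2 * X) / T + (X / n - 8 / (3 * pi) * ?s) / 2"
        unfolding T_def diff_divide_distrib using n by simp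
      also have "\<bar>\<dots>\<bar> \<le> \<bar>(harary_energy (coin_graph n w) - sqrt n / 2 * X) / T\<bar> + \<bar>(X / n - 8 / (3 * pi) * ?s) / 2\<bar>"
        by (rule abs_triangle_ineq)
      also have "\<dots> = \<bar>harary_energy (coin_graph n w) - sqrt n / 2 * X\<bar> / T + \<bar>X / n - 8 / (3 * pi) * ?s\<bar> / 2"
        using T by (simp add: abs_divide)
      finally show "\<bar>harary_energy (coin_graph n w) / (n * sqrt n) - 4 / (3 * pi) * ?s\<bar> \<le>
         (1 / sqrt n + sqrt n * (Z w / (n * n))) / 2 + 2 / sqrt n + \<bar>array_energy n (wigner n p w) / n - 8 / (3 * pi) * ?s\<bar> / 2"
        using 1 unfolding T_def X_def by linarith
    qed
    also have "\<dots> = (1 / sqrt n + sqrt n * (?E n Z / (n * n))) / 2 + 2 / sqrt n + a n / 2"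
      unfolding a_def by (simp add: Bochner_Integration.integral_add[OF int int])
    also have "\<dots> \<le> ?r n"
    proof -
      have "?E n Z / (n * n) \<le> 2 / ((real n - 2) * p ^ 4)"
        using EZ n by (simp add: divide_le_eq mult.commute)
      thus ?thesis by (intro add_mono divide_right_mono mult_left_mono order_refl) auto
    qed
    finally show ?thesis .
  qed
  have "eventually (\<lambda>n. measure_pmf.expectation (erdos_renyi n p)
      (\<lambda>G. \<bar>harary_energy G / (n * sqrt n) - 4 / (3 * pi) * ?s\<bar>) \<le> ?r n) sequentially"
    by (rule eventually_sequentiallyI[of 3], rule le) simp
  thus ?thesis
    by (rule tendsto_sandwich[OF _ _ tendsto_const lim, rotated])
      (auto intro!: always_eventually Bochner_Integration.integral_nonneg)
qed

theorem corollary3p2: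
  fixes p :: real
  assumes "0 < p" and "p < 1"
  shows "\<exists>\<epsilon> :: nat \<Rightarrow> real. \<epsilon> \<longlonglongrightarrow> 0 \<and>
    (\<lambda>n. measure_pmf.prob (erdos_renyi n p)
       {G. \<exists>\<delta>. \<bar>\<delta>\<bar> \<le> \<epsilon> n \<and>
         harary_energy G = (4 / (3 * pi) * sqrt (p * (1 - p)) + \<delta>) * real n powr (3 / 2)})
      \<longlonglongrightarrow> 1"
proof -
  let ?c = "4 / (3 * pi) * sqrt (p * (1 - p))"
  define f where "f n G = harary_energy G / (n * sqrt n) - ?c" for n :: nat and G
  have "finite (set_pmf (erdos_renyi n p))" for n
    unfolding erdos_renyi_def using finite_set_pmf_coins[OF finite_edges] by simp
  from convergence_in_mean_imp_in_probability[where P = "\<lambda>n. erdos_renyi n p" and f = f, OF this] harary_energy_in_mean[OF assms]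
  obtain \<epsilon> where \<epsilon>: "\<epsilon> \<longlonglongrightarrow> 0" "(\<lambda>n. measure_pmf.prob (erdos_renyi n p) {G. \<bar>f n G\<bar> \<le> \<epsilon> n}) \<longlonglongrightarrow> 1"
    unfolding f_def by blast
  have sub: "{G. \<bar>f n G\<bar> \<le> \<epsilon> n} \<subseteq> {G. \<exists>\<delta>. \<bar>\<delta>\<bar> \<le> \<epsilon> n \<and> harary_energy G = (?c + \<delta>) * real n powr (3 / 2)}"
    if n: "n > 0" for n
  proof (intro subsetI CollectI)
    fix G assume G: "G \<in> {G. \<bar>f n G\<bar> \<le> \<epsilon> n}"
    have "real n powr (3 / 2) = real n powr (1 + 1 / 2)" by simp
    also have "\<dots> = n * sqrt n" using n by (simp only: powr_add powr_half_sqrt) simp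
    finally have "harary_energy G = (?c + f n G) * real n powr (3 / 2)"
      using n unfolding f_def by simp
    thus "\<exists>\<delta>. \<bar>\<delta>\<bar> \<le> \<epsilon> n \<and> harary_energy G = (?c + \<delta>) * real n powr (3 / 2)" using G by blast
  qed
  show ?thesis
  proof (intro exI[of _ \<epsilon>] conjI \<epsilon>(1) tendsto_sandwich[OF _ _ \<epsilon>(2) tendsto_const])
    show "\<forall>\<^sub>F n in sequentially. measure_pmf.prob (erdos_renyi n p) {G. \<bar>f n G\<bar> \<le> \<epsilon> n} \<le>
      measure_pmf.prob (erdos_renyi n p) {G. \<exists>\<delta>. \<bar>\<delta>\<bar> \<le> \<epsilon> n \<and> harary_energy G = (?c + \<delta>) * real n powr (3 / 2)}"
      by (intro eventually_sequentiallyI[of 1] measure_pmf.finite_measure_mono sub) auto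
  qed (auto intro!: always_eventually)
qed

end
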